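(* The set of total recursive functions equals the set of functions with values in $\mathbb{N}$ (i.e. of the form $\mathbb{N}^p\to\mathbb{N}$) belonging to the smallest class of functions that contains the zero function $\mathbf 0$, the projections $\pi^p_i$, the successor $s$, addition $+$ and subtraction $-$ (on $\mathbb{Z}$), and that is closed under composition, the discrete linear ODE scheme $\mathrm{LI}$, and safe minimization.
   Context: Linear ODE scheme $\mathrm{LI}$: given $\mathbf G=(g_i)_{1\le i\le k}$ with $g_i:\mathbb{N}^p\to\mathbb{N}$, a $k\times k$ matrix $\mathbf A=(a_{i,j})$ and a vector $\mathbf B=(b_i)$ with $a_{i,j},b_i:\mathbb{N}^{p+1}\to\mathbb{Z}$, $\mathrm{LI}(\mathbf G,\mathbf A,\mathbf B)$ is the unique $\mathbf f:\mathbb{N}^{p+1}\to\mathbb{Z}^k$ with $\mathbf f(x+1,\mathbf y)-\mathbf f(x,\mathbf y)=\mathbf A(x,\mathbf y)\mathbf f(x,\mathbf y)+\mathbf B(x,\mathbf y)$ and $\mathbf f(0,\mathbf y)=\mathbf G(\mathbf y)$. Safe minimization: given $g:\mathbb{N}^{p+1}\to\mathbb{N}$ such that for every $\mathbf y$ there exists $x$ with $g(x,\mathbf y)=0$, $\mathrm{SMIN}(g):\mathbb{N}^p\to\mathbb{N}$ is $\mathbf y\mapsto\min\{x: g(x,\mathbf y)=0\}$. *)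

theory Defs
  imports Main "HOL-Library.NList"
begin

text \<open>
  A function with domain \<open>D\<close> is a map \<open>f\<close> with \<open>dom f = D\<close>; tuples are lists, and the power
  \<open>A\<^sup>p\<close> is \<open>nlists p A\<close>. A map thus determines its domain, and equal functions are equal maps.
\<close>

section \<open>Total recursive functions\<close>

definition comp_partial :: "nat \<Rightarrow> (nat list \<rightharpoonup> nat) \<Rightarrow> (nat list \<rightharpoonup> nat) list \<Rightarrow> nat list \<rightharpoonup> nat" where
  "comp_partial p f gs =
     (\<lambda>xs. if length xs = p \<and> (\<forall>g\<in>set gs. g xs \<noteq> None) then f (map (\<lambda>g. the (g xs)) gs) else None)"

fun prim_rec :: "(nat list \<rightharpoonup> nat) \<Rightarrow> (nat list \<rightharpoonup> nat) \<Rightarrow> nat list \<rightharpoonup> nat" where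
  "prim_rec g h [] = None"
| "prim_rec g h (0 # ys) = g ys"
| "prim_rec g h (Suc x # ys) =
     (case prim_rec g h (x # ys) of None \<Rightarrow> None | Some r \<Rightarrow> h (x # r # ys))"

definition minimization :: "(nat list \<rightharpoonup> nat) \<Rightarrow> nat list \<rightharpoonup> nat" where
  "minimization f ys =
     (let P = (\<lambda>x. f (x # ys) = Some 0 \<and> (\<forall>z<x. f (z # ys) \<noteq> None))
      in if \<exists>x. P x then Some (LEAST x. P x) else None)"

inductive partial_recursive :: "nat \<Rightarrow> (nat list \<rightharpoonup> nat) \<Rightarrow> bool" where
  zero: "partial_recursive p ((\<lambda>xs. Some 0) |` nlists p UNIV)"
| proj: "i < p \<Longrightarrow> partial_recursive p ((\<lambda>xs. Some (xs ! i)) |` nlists p UNIV)"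
| succ: "partial_recursive 1 ((\<lambda>xs. Some (Suc (xs ! 0))) |` nlists 1 UNIV)"
| comp: "partial_recursive (length gs) f \<Longrightarrow> (\<forall>g\<in>set gs. partial_recursive p g) \<Longrightarrow>
    partial_recursive p (comp_partial p f gs)"
| prec: "partial_recursive p g \<Longrightarrow> partial_recursive (p + 2) h \<Longrightarrow>
    partial_recursive (p + 1) (prim_rec g h)"
| mini: "partial_recursive (p + 1) f \<Longrightarrow> partial_recursive p (minimization f)"

definition total_recursive :: "(nat list \<rightharpoonup> nat) set" where
  "total_recursive = {f. \<exists>p. partial_recursive p f \<and> dom f = nlists p UNIV}"

section \<open>The class generated by linear ODEs and safe minimization\<close>

text \<open>
  Functions into \<open>\<int>\<^sup>k\<close> are families of \<open>k\<close> component functions, indexed by \<open>i < k\<close>. Being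
  \<open>\<nat>\<close>-valued is a property of the values, not part of a declared codomain. The components
  \<open>f i\<close>, \<open>i < k\<close>, with \<open>is_LI p k G A B f\<close> exist and are unique, by recursion on \<open>x\<close>.
\<close>

definition is_LI ::
  "nat \<Rightarrow> nat \<Rightarrow> (nat \<Rightarrow> int list \<rightharpoonup> int) \<Rightarrow> (nat \<Rightarrow> nat \<Rightarrow> int list \<rightharpoonup> int) \<Rightarrow>
     (nat \<Rightarrow> int list \<rightharpoonup> int) \<Rightarrow> (nat \<Rightarrow> int list \<rightharpoonup> int) \<Rightarrow> bool" where
  "is_LI p k G A B f \<longleftrightarrow>
     (\<forall>i<k. dom (f i) = nlists (p + 1) \<nat>) \<and>
     (\<forall>i<k. \<forall>y\<in>nlists p \<nat>. f i (0 # y) = G i y) \<and>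
     (\<forall>i<k. \<forall>x\<in>\<nat>. \<forall>y\<in>nlists p \<nat>.
        the (f i ((x + 1) # y)) - the (f i (x # y)) =
          (\<Sum>j<k. the (A i j (x # y)) * the (f j (x # y))) + the (B i (x # y)))"

text \<open>
  In \<open>comp\<close> the common domain \<open>nlists p S\<close> of the inner functions is explicit because the list
  \<open>gs\<close> may be empty.
\<close>

inductive_set ODE_class :: "(int list \<rightharpoonup> int) set" where
  zero: "(\<lambda>xs. Some 0) |` nlists p \<nat> \<in> ODE_class"
| proj: "i < p \<Longrightarrow> (\<lambda>xs. Some (xs ! i)) |` nlists p \<nat> \<in> ODE_class"
| succ: "(\<lambda>xs. Some (xs ! 0 + 1)) |` nlists 1 \<nat> \<in> ODE_class"
| add: "(\<lambda>xs. Some (xs ! 0 + xs ! 1)) |` nlists 2 UNIV \<in> ODE_class"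
| sub: "(\<lambda>xs. Some (xs ! 0 - xs ! 1)) |` nlists 2 UNIV \<in> ODE_class"
| comp: "f \<in> ODE_class \<Longrightarrow>
    S = \<nat> \<or> S = UNIV \<Longrightarrow>
    (\<forall>g\<in>set gs. g \<in> ODE_class \<and> dom g = nlists p S) \<Longrightarrow>
    (\<forall>xs\<in>nlists p S. map (\<lambda>g. the (g xs)) gs \<in> dom f) \<Longrightarrow>
    (\<lambda>xs. f (map (\<lambda>g. the (g xs)) gs)) |` nlists p S \<in> ODE_class"
| LI: "(\<forall>i<k. G i \<in> ODE_class \<and> dom (G i) = nlists p \<nat> \<and> ran (G i) \<subseteq> \<nat>) \<Longrightarrow>
    (\<forall>i<k. \<forall>j<k. A i j \<in> ODE_class \<and> dom (A i j) = nlists (p + 1) \<nat>) \<Longrightarrow>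
    (\<forall>i<k. B i \<in> ODE_class \<and> dom (B i) = nlists (p + 1) \<nat>) \<Longrightarrow>
    is_LI p k G A B f \<Longrightarrow> i < k \<Longrightarrow> f i \<in> ODE_class"
| SMIN: "g \<in> ODE_class \<Longrightarrow> dom g = nlists (p + 1) \<nat> \<Longrightarrow> ran g \<subseteq> \<nat> \<Longrightarrow>
    (\<forall>y\<in>nlists p \<nat>. \<exists>n::nat. g (int n # y) = Some 0) \<Longrightarrow>
    (\<lambda>y. Some (int (LEAST n. g (int n # y) = Some 0))) |` nlists p \<nat> \<in> ODE_class"

text \<open>The inclusion of \<open>\<nat>\<close> into \<open>\<int>\<close>, applied to the arguments and values of a function.\<close>

definition int_fun :: "(nat list \<rightharpoonup> nat) \<Rightarrow> int list \<rightharpoonup> int" where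
  "int_fun f = (\<lambda>xs. if set xs \<subseteq> \<nat> then map_option int (f (map nat xs)) else None)"

end

theory Submission imports Defs "HOL-Library.Nat_Bijection" begin

text \<open>
  Linear ODEs yield bounded sums, bounded products and, through \<open>(x - y)\<^sup>2\<close>, the equality test, hence
  relations closed under bounded quantification. Every partial recursive \<open>f\<close> therefore has a
  decidable relation stating that \<open>f xs = v\<close> is confirmed by witnesses below \<open>t\<close>; a primitive recursion
  is witnessed by the base-\<open>b\<close> digits of a single number. If \<open>f\<close> is total, two safe minimizations find
  first \<open>t\<close> and then \<open>v\<close>.

  Conversely, an integer is coded by a pair of natural numbers with that difference, and every function
  of the class is tracked by a total recursive function on codes. Codes need not be unique, so the
  argument of a minimization is first normalized to natural numbers: the tracking function
  must be total even where the tracked function is undefined. A linear system is a primitive recursion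
  on the coded state vector.
\<close>

section \<open>Clones of functions on the natural numbers\<close>

lemma map_nth_add_upt: "length xs = m + l \<Longrightarrow> map (\<lambda>i. xs ! (m + i)) [0..<l] = drop m xs"
  by (rule nth_equalityI) auto

text \<open>Only values at lists of length \<open>p\<close> count, whence \<open>cong\<close>. Both
  \<open>ode\<close> and \<open>recursive\<close> are instances, so substitution is derived once for
  the two directions.\<close>

locale clone =
  fixes K :: "nat \<Rightarrow> (nat list \<Rightarrow> nat) \<Rightarrow> bool"
  assumes cong: "K p F \<Longrightarrow> (\<And>xs. length xs = p \<Longrightarrow> F xs = F' xs) \<Longrightarrow> K p F'"
    and proj: "i < p \<Longrightarrow> K p (\<lambda>xs. xs ! i)"
    and comp: "K (length Gs) F \<Longrightarrow> (\<And>G. G \<in> set Gs \<Longrightarrow> K p G) \<Longrightarrow> K p (\<lambda>xs. F (map (\<lambda>G. G xs) Gs))"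
    and zero: "K p (\<lambda>xs. 0)"
    and Suc1: "K 1 (\<lambda>xs. Suc (xs ! 0))"
begin

lemma comp1: "K 1 (\<lambda>xs. f (xs ! 0)) \<Longrightarrow> K p G \<Longrightarrow> K p (\<lambda>xs. f (G xs))"
  using comp[of "[G]" "\<lambda>xs. f (xs ! 0)" p] by simp

lemma comp2: "K 2 (\<lambda>xs. f (xs ! 0) (xs ! 1)) \<Longrightarrow> K p G \<Longrightarrow> K p H \<Longrightarrow> K p (\<lambda>xs. f (G xs) (H xs))"
  using comp[of "[G, H]" "\<lambda>xs. f (xs ! 0) (xs ! 1)" p] by (auto simp: numeral_2_eq_2)

lemma Suc: "K p F \<Longrightarrow> K p (\<lambda>xs. Suc (F xs))"
  using comp1[of Suc] Suc1 by simp

lemma const: "K p (\<lambda>xs. c)"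
  by (induction c) (auto intro: zero Suc)

text \<open>Variables are list positions, and a bound variable is put in front of the others.
  Substitution therefore computes the leading arguments and passes on the parameters that remain
  after \<open>m\<close> leading variables are dropped.\<close>

lemma subst:
  assumes F: "K n F" and n: "length Gs + l = n" and q: "m + l = q"
    and Gs: "\<And>G. G \<in> set Gs \<Longrightarrow> K q G"
  shows "K q (\<lambda>xs. F (map (\<lambda>G. G xs) Gs @ drop m xs))"
proof -
  let ?P = "map (\<lambda>i xs. xs ! (m + i)) [0..<l]"
  have "K q (\<lambda>xs. F (map (\<lambda>G. G xs) (Gs @ ?P)))"
    by (rule comp) (use F n q Gs in \<open>auto intro: proj\<close>)
  then show ?thesis
    by (rule cong) (use q in \<open>simp add: comp_def map_nth_add_upt\<close>)
qed

lemma weaken: "K l F \<Longrightarrow> m + l = q \<Longrightarrow> K q (\<lambda>xs. F (drop m xs))"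
  using subst[of l F "[]" l m q] by simp

end

section \<open>Functions generated by linear ODEs and safe minimization\<close>

text \<open>Arguments are natural numbers but values are integers, because the coefficients of a
  linear ODE may be negative.\<close>

definition ode_int :: "nat \<Rightarrow> (nat list \<Rightarrow> int) \<Rightarrow> bool" where
  "ode_int p F \<longleftrightarrow> (\<lambda>xs. Some (F (map nat xs))) |` nlists p \<nat> \<in> ODE_class"

definition ode :: "nat \<Rightarrow> (nat list \<Rightarrow> nat) \<Rightarrow> bool" where
  "ode p F \<longleftrightarrow> ode_int p (\<lambda>xs. int (F xs))"

text \<open>As simplification rules these make the simplifier loop in combination with \<open>in_nlists_iff\<close>.\<close>

declare nlistsE_length [simp del] nlistsE_set [simp del]

lemma in_nlists_iff: "xs \<in> nlists p A \<longleftrightarrow> length xs = p \<and> set xs \<subseteq> A"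
  by (simp add: nlists_def)

lemma dom_restrict_Some [simp]: "dom ((\<lambda>xs. Some (F xs)) |` A) = A"
  by (auto simp: restrict_map_def dom_def)

lemma ran_restrict_Some [simp]: "ran ((\<lambda>xs. Some (F xs)) |` A) = F ` A"
  by (auto simp: restrict_map_def ran_def)

lemma restrict_map_cong: "(\<And>x. x \<in> A \<Longrightarrow> f x = g x) \<Longrightarrow> f |` A = g |` A"
  by (auto simp: restrict_map_def)

lemma Nats_int_nonneg: "x \<in> \<nat> \<Longrightarrow> 0 \<le> x" for x :: int
  by (auto elim: Nats_cases)

lemma nth_map_nat: "set xs \<subseteq> \<nat> \<Longrightarrow> i < length xs \<Longrightarrow> int (map nat xs ! i) = xs ! i"
  using Nats_int_nonneg[of "xs ! i"] nth_mem[of i xs] by (simp add: subset_iff del: nth_mem)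

lemma ode_int_cong:
  "ode_int p F \<Longrightarrow> (\<And>xs. length xs = p \<Longrightarrow> F xs = F' xs) \<Longrightarrow> ode_int p F'"
  unfolding ode_int_def
  using restrict_map_cong[of "nlists p \<nat>" "\<lambda>xs. Some (F (map nat xs))" "\<lambda>xs. Some (F' (map nat xs))"]
  by (simp add: in_nlists_iff)

lemma ode_int_comp:
  assumes F: "ode_int (length Gs) F" and Gs: "\<And>G. G \<in> set Gs \<Longrightarrow> ode p G"
  shows "ode_int p (\<lambda>xs. F (map (\<lambda>G. G xs) Gs))"
proof -
  let ?g = "\<lambda>G. (\<lambda>xs. Some (int (G (map nat xs)))) |` nlists p \<nat>"
  let ?f = "(\<lambda>xs. Some (F (map nat xs))) |` nlists (length Gs) \<nat>"
  have args: "map (\<lambda>g. the (g xs)) (map ?g Gs) = map (\<lambda>G. int (G (map nat xs))) Gs"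
    if "xs \<in> nlists p \<nat>" for xs
    using that by simp
  have in_dom: "map (\<lambda>G. int (G (map nat xs))) Gs \<in> nlists (length Gs) \<nat>" for xs
    by (auto simp: in_nlists_iff)
  have "(\<lambda>xs. ?f (map (\<lambda>g. the (g xs)) (map ?g Gs))) |` nlists p \<nat> \<in> ODE_class"
  proof (rule ODE_class.comp)
    show "\<forall>xs\<in>nlists p \<nat>. map (\<lambda>g. the (g xs)) (map ?g Gs) \<in> dom ?f"
      using in_dom by (simp add: args del: map_map)
  qed (use F Gs in \<open>auto simp: ode_def ode_int_def\<close>)
  also have "(\<lambda>xs. ?f (map (\<lambda>g. the (g xs)) (map ?g Gs))) |` nlists p \<nat> =
      (\<lambda>xs. Some (F (map (\<lambda>G. G (map nat xs)) Gs))) |` nlists p \<nat>"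
    by (rule restrict_map_cong) (use in_dom in \<open>simp add: args comp_def del: map_map, simp add: comp_def\<close>)
  finally show ?thesis
    by (simp add: ode_int_def)
qed

lemma ode_cong: "ode p F \<Longrightarrow> (\<And>xs. length xs = p \<Longrightarrow> F xs = F' xs) \<Longrightarrow> ode p F'"
  unfolding ode_def by (erule ode_int_cong) simp

lemma ode_proj:
  assumes "i < p"
  shows "ode p (\<lambda>xs. xs ! i)"
proof -
  have "(\<lambda>xs. Some (int (map nat xs ! i))) |` nlists p \<nat> = (\<lambda>xs. Some (xs ! i)) |` nlists p \<nat>"
    by (rule restrict_map_cong) (use assms in \<open>simp add: in_nlists_iff nth_map_nat del: nth_map\<close>)
  then show ?thesis
    using ODE_class.proj[OF assms] by (simp add: ode_def ode_int_def)
qed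

lemma ode_Suc: "ode 1 (\<lambda>xs. Suc (xs ! 0))"
proof -
  have "(\<lambda>xs. Some (int (Suc (map nat xs ! 0)))) |` nlists 1 \<nat> = (\<lambda>xs. Some (xs ! 0 + 1)) |` nlists 1 \<nat>"
    by (rule restrict_map_cong) (simp add: in_nlists_iff nth_map_nat del: nth_map)
  then show ?thesis
    unfolding ode_def ode_int_def using ODE_class.succ by metis
qed

lemma clone_ode: "clone ode"
  apply (rule clone.intro)
  subgoal for p F F' by (rule ode_cong[of p F F'])
  subgoal by (rule ode_proj)
  subgoal for Gs F p using ode_int_comp[of Gs "\<lambda>xs. int (F xs)" p] by (simp only: ode_def)
  subgoal by (simp add: ode_def ode_int_def ODE_class.zero)
  subgoal by (rule ode_Suc)
  done

interpretation ode: clone ode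
  by (rule clone_ode)

text \<open>Addition and subtraction are generators defined on all pairs of integers, so the inner
  functions may take negative values here, whereas \<open>ode_int_comp\<close> asks for natural
  ones.\<close>

lemma ode_int_binary:
  assumes f: "(\<lambda>xs. Some (f (xs ! 0) (xs ! 1))) |` nlists 2 UNIV \<in> ODE_class"
    and F: "ode_int p F" and G: "ode_int p G"
  shows "ode_int p (\<lambda>xs. f (F xs) (G xs))"
proof -
  let ?f = "(\<lambda>xs. Some (f (xs ! 0) (xs ! 1))) |` nlists 2 UNIV"
  let ?gs = "[(\<lambda>xs. Some (F (map nat xs))) |` nlists p \<nat>, (\<lambda>xs. Some (G (map nat xs))) |` nlists p \<nat>]"
  have "(\<lambda>xs. ?f (map (\<lambda>g. the (g xs)) ?gs)) |` nlists p \<nat> \<in> ODE_class"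
    by (rule ODE_class.comp) (use f F G in \<open>auto simp: ode_int_def in_nlists_iff\<close>)
  also have "(\<lambda>xs. ?f (map (\<lambda>g. the (g xs)) ?gs)) |` nlists p \<nat> =
      (\<lambda>xs. Some (f (F (map nat xs)) (G (map nat xs)))) |` nlists p \<nat>"
    by (rule restrict_map_cong) (simp add: in_nlists_iff)
  finally show ?thesis
    by (simp add: ode_int_def)
qed

lemmas ode_int_add = ode_int_binary[of "(+)", OF ODE_class.add]
lemmas ode_int_diff = ode_int_binary[of "(-)", OF ODE_class.sub]

lemma ode_add: "ode p F \<Longrightarrow> ode p G \<Longrightarrow> ode p (\<lambda>xs. F xs + G xs)"
  using ode_int_add by (simp add: ode_def)

text \<open>\<open>le\<close> excludes truncation, so subtraction of natural numbers agrees with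
  subtraction of integers.\<close>

lemma ode_diff:
  assumes F: "ode p F" and G: "ode p G" and le: "\<And>xs. length xs = p \<Longrightarrow> G xs \<le> F xs"
  shows "ode p (\<lambda>xs. F xs - G xs)"
  using ode_int_diff[OF F[unfolded ode_def] G[unfolded ode_def]] unfolding ode_def
  by (rule ode_int_cong) (simp add: le of_nat_diff)

text \<open>The scheme with \<open>k = 1\<close>, its difference equation solved for
  \<open>F (Suc x # ys)\<close>.\<close>

lemma ode_int_LI:
  assumes G: "ode p G" and A: "ode_int (Suc p) A" and B: "ode_int (Suc p) B"
    and F0: "\<And>ys. length ys = p \<Longrightarrow> F (0 # ys) = int (G ys)"
    and FS: "\<And>x ys. length ys = p \<Longrightarrow>
      F (Suc x # ys) = F (x # ys) + A (x # ys) * F (x # ys) + B (x # ys)"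
  shows "ode_int (Suc p) F"
proof -
  let ?m = "\<lambda>p F. (\<lambda>xs. Some (F (map nat xs))) |` nlists p \<nat>"
  have "is_LI p (Suc 0) (\<lambda>_. ?m p (\<lambda>xs. int (G xs))) (\<lambda>_ _. ?m (Suc p) A) (\<lambda>_. ?m (Suc p) B) (\<lambda>_. ?m (Suc p) F)"
    unfolding is_LI_def
  proof (intro conjI allI impI ballI)
    fix x :: int and ys :: "int list" assume x: "x \<in> \<nat>" and ys: "ys \<in> nlists p \<nat>"
    then obtain n where [simp]: "x = int n" by (auto elim: Nats_cases)
    have [simp]: "nat (int n + 1) = Suc n" "1 + int n \<in> \<nat>" "int n + 1 \<in> \<nat>"
      by (auto intro: Nats_add)
    show "the (?m (Suc p) F ((x + 1) # ys)) - the (?m (Suc p) F (x # ys)) =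
        (\<Sum>j<Suc 0. the (?m (Suc p) A (x # ys)) * the (?m (Suc p) F (x # ys))) + the (?m (Suc p) B (x # ys))"
      using x ys by (simp add: in_nlists_iff FS)
  qed (auto simp: in_nlists_iff F0)
  from ODE_class.LI[OF _ _ _ this] show ?thesis
    using G A B by (auto simp: ode_def ode_int_def image_subset_iff)
qed

section \<open>Arithmetic, bounded sums and bounded products\<close>

lemma ode_int_0: "ode_int p (\<lambda>_. 0)"
  using ode.const[of p 0] by (simp add: ode_def)

lemma ode_int_minus_1:
  assumes "ode_int p F"
  shows "ode_int p (\<lambda>xs. F xs - 1)"
  using ode_int_diff[OF assms, of "\<lambda>_. 1"] ode.const[of p 1] by (simp add: ode_def)

lemma ode_mult: "ode p F \<Longrightarrow> ode p G \<Longrightarrow> ode p (\<lambda>xs. F xs * G xs)"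
proof (rule ode.comp2[of "(*)"])
  have "ode_int 2 (\<lambda>xs. int (xs ! 1))"
    using ode.proj[of 1 2] by (simp add: ode_def)
  \<comment> \<open>As a function of \<open>x\<close>, the product \<open>x * y\<close> starts at 0
    and has constant difference \<open>y\<close>.\<close>
  then show "ode 2 (\<lambda>xs. xs ! 0 * xs ! 1)"
    unfolding ode_def numeral_2_eq_2
    by (rule_tac ode_int_LI[where G = "\<lambda>_. 0" and A = "\<lambda>_. 0" and B = "\<lambda>xs. int (xs ! 1)"])
      (simp_all add: ode.const ode_int_0 algebra_simps)
qed

text \<open>Start at 1 with \<open>A = -1\<close>: the first step gives \<open>1 - 1 = 0\<close>,
  and 0 is then a fixed point.\<close>

lemma ode_is_zero: "ode p F \<Longrightarrow> ode p (\<lambda>xs. of_bool (F xs = 0))"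
proof (rule ode.comp1[of "\<lambda>x. of_bool (x = 0)"])
  show "ode 1 (\<lambda>xs. of_bool (xs ! 0 = 0))"
    unfolding ode_def One_nat_def
    by (rule ode_int_LI[where G = "\<lambda>_. 1" and A = "\<lambda>_. 0 - 1" and B = "\<lambda>_. 0"])
      (simp_all only: ode.const ode_int_0 ode_int_minus_1, simp_all)
qed

text \<open>The upper bound is first a new leading argument. A partial sum has difference
  \<open>F\<close>, so \<open>A = 0\<close> and \<open>B = F\<close>. Then \<open>N\<close> is
  substituted for the bound.\<close>

lemma ode_sum:
  assumes F: "ode (Suc p) F" and N: "ode p N"
  shows "ode p (\<lambda>xs. \<Sum>i<N xs. F (i # xs))"
proof -
  have "ode (Suc p) (\<lambda>xs. \<Sum>i<xs ! 0. F (i # drop 1 xs))"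
    unfolding ode_def
    by (rule ode_int_LI[where G = "\<lambda>_. 0" and A = "\<lambda>_. 0" and B = "\<lambda>xs. int (F xs)"])
      (simp_all add: F[unfolded ode_def] ode_int_0 ode.const)
  from ode.subst[OF this, of "[N]" p 0] show ?thesis
    using N by simp
qed

text \<open>A partial product \<open>P\<close> satisfies
  \<open>P (x + 1) - P x = (F x - 1) * P x\<close>. The coefficient is negative where
  \<open>F\<close> vanishes, so \<open>A\<close> has to be integer valued.\<close>

lemma ode_prod:
  assumes F: "ode (Suc p) F" and N: "ode p N"
  shows "ode p (\<lambda>xs. \<Prod>i<N xs. F (i # xs))"
proof -
  have "ode (Suc p) (\<lambda>xs. \<Prod>i<xs ! 0. F (i # drop 1 xs))"
    unfolding ode_def
    by (rule ode_int_LI[where G = "\<lambda>_. 1" and A = "\<lambda>xs. int (F xs) - 1" and B = "\<lambda>_. 0"])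
      (simp_all add: F[unfolded ode_def] ode_int_0 ode_int_minus_1 ode.const algebra_simps)
  from ode.subst[OF this, of "[N]" p 0] show ?thesis
    using N by simp
qed

subsection \<open>Decidable relations\<close>

definition ode_rel :: "nat \<Rightarrow> (nat list \<Rightarrow> bool) \<Rightarrow> bool" where
  "ode_rel p Q \<longleftrightarrow> ode p (\<lambda>xs. of_bool (Q xs))"

lemma ode_rel_cong:
  "ode_rel p Q \<Longrightarrow> (\<And>xs. length xs = p \<Longrightarrow> Q xs \<longleftrightarrow> Q' xs) \<Longrightarrow> ode_rel p Q'"
  unfolding ode_rel_def by (erule ode.cong) simp

lemma ode_rel_subst:
  "ode_rel n Q \<Longrightarrow> length Gs + l = n \<Longrightarrow> m + l = q \<Longrightarrow> list_all (ode q) Gs \<Longrightarrow>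
    ode_rel q (\<lambda>xs. Q (map (\<lambda>G. G xs) Gs @ drop m xs))"
  unfolding ode_rel_def by (rule ode.subst) (auto simp: list_all_iff)

lemma ode_rel_not: "ode_rel p Q \<Longrightarrow> ode_rel p (\<lambda>xs. \<not> Q xs)"
  using ode_is_zero[of p "\<lambda>xs. of_bool (Q xs)"] by (simp add: ode_rel_def)

lemma ode_rel_conj: "ode_rel p Q \<Longrightarrow> ode_rel p Q' \<Longrightarrow> ode_rel p (\<lambda>xs. Q xs \<and> Q' xs)"
  using ode_mult[of p "\<lambda>xs. of_bool (Q xs)" "\<lambda>xs. of_bool (Q' xs)"]
  by (simp add: ode_rel_def of_bool_conj)

text \<open>Truth values multiply to 1 exactly if all of them are 1.\<close>

lemma ode_rel_all_less:
  assumes "ode_rel (Suc p) Q" "ode p N"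
  shows "ode_rel p (\<lambda>xs. \<forall>i<N xs. Q (i # xs))"
  using ode_prod[OF assms[unfolded ode_rel_def]] unfolding ode_rel_def
  by (rule ode.cong) (auto simp: of_bool_def)

lemma ode_rel_ex_less:
  "ode_rel (Suc p) Q \<Longrightarrow> ode p N \<Longrightarrow> ode_rel p (\<lambda>xs. \<exists>i<N xs. Q (i # xs))"
  using ode_rel_not[OF ode_rel_all_less[OF ode_rel_not, of p Q N]] by simp

lemma ode_rel_ball_lessThan: "(\<And>i. i < n \<Longrightarrow> ode_rel p (Q i)) \<Longrightarrow> ode_rel p (\<lambda>xs. \<forall>i<n. Q i xs)"
  for n :: nat
proof (induction n)
  case 0
  then show ?case by (simp add: ode_rel_def ode.const)
next
  case (Suc n)
  then have "ode_rel p (\<lambda>xs. (\<forall>i<n. Q i xs) \<and> Q n xs)"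
    by (intro ode_rel_conj) auto
  then show ?case
    by (rule ode_rel_cong) (auto simp: less_Suc_eq)
qed

text \<open>This serves to guess the intermediate values of a composition, whose number
  \<open>n\<close> is fixed.\<close>

lemma ode_rel_ex_list:
  assumes "ode_rel (n + p) Q" "ode p N"
  shows "ode_rel p (\<lambda>xs. \<exists>vs. length vs = n \<and> (\<forall>v\<in>set vs. v < N xs) \<and> Q (vs @ xs))"
  using assms
proof (induction n arbitrary: p N)
  case 0
  then show ?case by simp
next
  case (Suc n)
  \<comment> \<open>The last entry of the list stands next to \<open>xs\<close> and is quantified
    outermost. The bound for the other entries has to skip it.\<close>
  have "ode (Suc p) (\<lambda>xs. N (drop 1 xs))"
    by (rule ode.weaken[OF Suc.prems(2)]) simp
  then have "ode_rel p (\<lambda>xs. \<exists>v<N xs. \<exists>vs. length vs = n \<and> (\<forall>v\<in>set vs. v < N xs) \<and> Q (vs @ v # xs))"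
    using ode_rel_ex_less[OF Suc.IH[of "Suc p" "\<lambda>xs. N (drop 1 xs)"], of N] Suc.prems by simp
  moreover have "(\<exists>v<N xs. \<exists>vs. length vs = n \<and> (\<forall>v\<in>set vs. v < N xs) \<and> Q (vs @ v # xs)) \<longleftrightarrow>
      (\<exists>vs. length vs = Suc n \<and> (\<forall>v\<in>set vs. v < N xs) \<and> Q (vs @ xs))" for xs
  proof safe
    fix v vs assume "v < N xs" "\<forall>v\<in>set vs. v < N xs" "Q (vs @ v # xs)"
    then show "\<exists>us. length us = Suc (length vs) \<and> (\<forall>v\<in>set us. v < N xs) \<and> Q (us @ xs)"
      by (intro exI[of _ "vs @ [v]"]) auto
  next
    fix us assume "length us = Suc n" "\<forall>v\<in>set us. v < N xs" "Q (us @ xs)"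
    then show "\<exists>v<N xs. \<exists>vs. length vs = n \<and> (\<forall>v\<in>set vs. v < N xs) \<and> Q (vs @ v # xs)"
      by (cases us rule: rev_cases) auto
  qed
  ultimately show ?case by simp
qed

text \<open>The difference itself may be negative, but its square is not. So \<open>ode_diff\<close>
  applies to the expanded square, and the zero test decides equality.\<close>

lemma ode_rel_eq:
  assumes F: "ode p F" and G: "ode p G"
  shows "ode_rel p (\<lambda>xs. F xs = G xs)"
proof -
  have square: "int (F xs * F xs + G xs * G xs) - int (2 * (F xs * G xs)) = (int (F xs) - int (G xs))\<^sup>2" for xs
    by (simp add: power2_eq_square algebra_simps)
  have le: "2 * (F xs * G xs) \<le> F xs * F xs + G xs * G xs" for xs
    using square[of xs] zero_le_power2[of "int (F xs) - int (G xs)"] by linarith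
  have "ode p (\<lambda>xs. F xs * F xs + G xs * G xs - 2 * (F xs * G xs))"
    by (intro ode_diff ode_add ode_mult ode.const F G le)
  from ode_is_zero[OF this] show ?thesis
    unfolding ode_rel_def
  proof (rule ode.cong)
    fix xs
    have "F xs * F xs + G xs * G xs - 2 * (F xs * G xs) = 0 \<longleftrightarrow> (int (F xs) - int (G xs))\<^sup>2 = 0"
      unfolding square[symmetric] using le[of xs] by linarith
    then show "of_bool (F xs * F xs + G xs * G xs - 2 * (F xs * G xs) = 0) = of_bool (F xs = G xs)"
      by simp
  qed
qed

text \<open>Search below \<open>Suc (G xs)\<close> for a number equal to
  \<open>F xs\<close>.\<close>

lemma ode_rel_le:
  assumes F: "ode p F" and G: "ode p G"
  shows "ode_rel p (\<lambda>xs. F xs \<le> G xs)"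
proof -
  have "ode_rel (Suc p) (\<lambda>xs. xs ! 0 = F (drop 1 xs))"
    by (intro ode_rel_eq ode.proj ode.weaken[OF F]) auto
  from ode_rel_ex_less[OF this ode.Suc[OF G]] show ?thesis
    by (rule ode_rel_cong) auto
qed

lemma ode_LEAST:
  assumes Q: "ode_rel (Suc p) Q" and ex: "\<And>xs. length xs = p \<Longrightarrow> \<exists>n. Q (n # xs)"
  shows "ode p (\<lambda>xs. LEAST n. Q (n # xs))"
proof -
  \<comment> \<open>Safe minimization looks for a zero, hence the truth value of the
    negation.\<close>
  let ?g = "(\<lambda>xs. Some (int (of_bool (\<not> Q (map nat xs))))) |` nlists (p + 1) \<nat>"
  have "?g \<in> ODE_class"
    using ode_rel_not[OF Q] by (simp add: ode_rel_def ode_def ode_int_def)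
  moreover have zero_iff: "?g (int n # ys) = Some 0 \<longleftrightarrow> Q (n # map nat ys)" if "ys \<in> nlists p \<nat>" for n ys
    using that by (simp add: in_nlists_iff)
  moreover have "\<exists>n::nat. ?g (int n # ys) = Some 0" if "ys \<in> nlists p \<nat>" for ys
    unfolding zero_iff[OF that] by (rule ex) (use that in \<open>simp add: in_nlists_iff\<close>)
  ultimately have "(\<lambda>ys. Some (int (LEAST n. ?g (int n # ys) = Some 0))) |` nlists p \<nat> \<in> ODE_class"
    by (intro ODE_class.SMIN) auto
  also have "(\<lambda>ys. Some (int (LEAST n. ?g (int n # ys) = Some 0))) |` nlists p \<nat> =
      (\<lambda>ys. Some (int (LEAST n. Q (n # map nat ys)))) |` nlists p \<nat>"
    by (rule restrict_map_cong) (simp only: zero_iff)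
  finally show ?thesis
    by (simp add: ode_def ode_int_def)
qed

subsection \<open>Coding of sequences by digits\<close>

lemma ode_power: "ode p F \<Longrightarrow> ode p G \<Longrightarrow> ode p (\<lambda>xs. F xs ^ G xs)"
  using ode_prod[OF ode.weaken[of p F 1 "Suc p"], of G] by simp

text \<open>The quotient counts the positive multiples \<open>Suc i * b\<close> up to
  \<open>a\<close>. Since \<open>b\<close> is positive, only \<open>i < a\<close> can occur.\<close>

lemma div_eq_sum:
  assumes "0 < (b::nat)"
  shows "a div b = (\<Sum>i<a. of_bool (Suc i * b \<le> a))"
proof -
  have "Suc i * b \<le> a \<longleftrightarrow> i < a div b" for i
    using less_eq_div_iff_mult_less_eq[OF assms, of "Suc i" a] by (simp add: Suc_le_eq)
  moreover have "{i. i < a \<and> i < a div b} = {..<a div b}"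
    using div_le_dividend[of a b] by (auto intro: less_le_trans)
  ultimately show ?thesis
    by (simp add: sum_of_bool_eq Int_def lessThan_def)
qed

lemma ode_div:
  assumes F: "ode p F" and G: "ode p G" and pos: "\<And>xs. length xs = p \<Longrightarrow> 0 < G xs"
  shows "ode p (\<lambda>xs. F xs div G xs)"
proof -
  have "ode_rel (Suc p) (\<lambda>xs. Suc (xs ! 0) * G (drop 1 xs) \<le> F (drop 1 xs))"
    by (intro ode_rel_le ode_mult ode.Suc ode.proj ode.weaken[OF F] ode.weaken[OF G]) auto
  from ode_sum[OF this[unfolded ode_rel_def] F] show ?thesis
    by (rule ode.cong) (simp add: div_eq_sum pos)
qed

lemma ode_mod:
  assumes F: "ode p F" and G: "ode p G" and pos: "\<And>xs. length xs = p \<Longrightarrow> 0 < G xs"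
  shows "ode p (\<lambda>xs. F xs mod G xs)"
proof -
  have "ode p (\<lambda>xs. F xs - F xs div G xs * G xs)"
    by (intro ode_diff ode_mult ode_div F G pos) auto
  then show ?thesis
    by (simp add: minus_div_mult_eq_mod)
qed

text \<open>The successor keeps the base positive.\<close>

definition digit :: "nat \<Rightarrow> nat \<Rightarrow> nat \<Rightarrow> nat" where
  "digit b c i = c div Suc b ^ i mod Suc b"

lemma ode_digit: "ode p B \<Longrightarrow> ode p C \<Longrightarrow> ode p I \<Longrightarrow> ode p (\<lambda>xs. digit (B xs) (C xs) (I xs))"
  unfolding digit_def by (intro ode_mod ode_div ode_power ode.Suc) auto

lemma ex_digits: "(\<And>i. i < n \<Longrightarrow> r i \<le> b) \<Longrightarrow> \<exists>c. \<forall>i<n. digit b c i = r i"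
proof (induction n arbitrary: r)
  case (Suc n)
  from Suc.IH[of "\<lambda>i. r (Suc i)"] Suc.prems obtain c where c: "\<forall>i<n. digit b c i = r (Suc i)"
    by auto
  \<comment> \<open>Horner's scheme: \<open>r 0\<close> becomes the lowest digit, and the later
    digits, carried by \<open>c\<close>, move up by one place.\<close>
  have "digit b (r 0 + Suc b * c) i = r i" if "i < Suc n" for i
  proof (cases i)
    case 0
    then show ?thesis using Suc.prems[of 0] by (simp add: digit_def del: mult_Suc)
  next
    case (Suc j)
    have "(r 0 + Suc b * c) div Suc b ^ Suc j = c div Suc b ^ j"
      using Suc.prems[of 0] by (simp add: div_mult2_eq del: mult_Suc)
    then show ?thesis using c Suc that by (simp add: digit_def)
  qed
  then show ?case by blast
qed simp

section \<open>Recursive functions are generated by linear ODEs and safe minimization\<close>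

text \<open>
  \<open>Q (t # v # xs)\<close> expresses that \<open>f xs = v\<close> is confirmed by witnesses bounded by \<open>t\<close>.
\<close>

definition confirms :: "nat \<Rightarrow> (nat list \<Rightarrow> bool) \<Rightarrow> (nat list \<rightharpoonup> nat) \<Rightarrow> bool" where
  "confirms p Q f \<longleftrightarrow> ode_rel (p + 2) Q \<and>
     (\<forall>t v xs. length xs = p \<longrightarrow> Q (t # v # xs) \<longrightarrow> f xs = Some v) \<and>
     (\<forall>v xs. length xs = p \<longrightarrow> f xs = Some v \<longrightarrow> (\<forall>\<^sub>F t in sequentially. Q (t # v # xs)))"

text \<open>The recursion is unrolled into a trace \<open>r\<close> of its values. Only
  \<open>r 0\<close> to \<open>r x\<close> are constrained, so the trace can later be given by
  finitely many digits.\<close>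

lemma prim_rec_eq_Some_iff:
  "prim_rec g h (x # ys) = Some v \<longleftrightarrow>
     (\<exists>r. g ys = Some (r 0) \<and> (\<forall>i<x. h (i # r i # ys) = Some (r (Suc i))) \<and> r x = v)"
proof (induction x arbitrary: v)
  case 0
  show ?case by auto
next
  case (Suc x)
  show ?case
  proof
    assume "prim_rec g h (Suc x # ys) = Some v"
    then obtain w where w: "prim_rec g h (x # ys) = Some w" "h (x # w # ys) = Some v"
      by (auto split: option.splits)
    then obtain r where "g ys = Some (r 0)" "\<forall>i<x. h (i # r i # ys) = Some (r (Suc i))" "r x = w"
      using Suc.IH by blast
    with w show "\<exists>r. g ys = Some (r 0) \<and> (\<forall>i<Suc x. h (i # r i # ys) = Some (r (Suc i))) \<and> r (Suc x) = v"
      by (intro exI[of _ "r(Suc x := v)"]) (auto simp: less_Suc_eq)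
  next
    assume "\<exists>r. g ys = Some (r 0) \<and> (\<forall>i<Suc x. h (i # r i # ys) = Some (r (Suc i))) \<and> r (Suc x) = v"
    then obtain r where r: "g ys = Some (r 0)" "\<forall>i<Suc x. h (i # r i # ys) = Some (r (Suc i))" "r (Suc x) = v"
      by blast
    then have "prim_rec g h (x # ys) = Some (r x)"
      using Suc.IH by auto
    with r show "prim_rec g h (Suc x # ys) = Some v" by simp
  qed
qed

text \<open>A list \<open>zs\<close> holds \<open>t\<close>, then the value, then the arguments. The
  values \<open>vs\<close> of the inner functions are guessed below \<open>t\<close>, and the same
  \<open>t\<close> confirms all of them.\<close>

lemma confirms_comp:
  assumes f: "confirms (length gs) Qf f" and gs: "\<And>g. g \<in> set gs \<Longrightarrow> confirms p (Qg g) g"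
  shows "confirms p (\<lambda>zs. \<exists>vs. length vs = length gs \<and> (\<forall>v\<in>set vs. v < zs ! 0) \<and>
    (\<forall>i<length gs. Qg (gs ! i) (zs ! 0 # vs ! i # drop 2 zs)) \<and> Qf (zs ! 0 # zs ! 1 # vs)) (comp_partial p f gs)"
    (is "confirms p ?Q _")
proof -
  let ?n = "length gs"
  have gsi: "confirms p (Qg (gs ! i)) (gs ! i)" if "i < ?n" for i
    using gs that by simp
  \<comment> \<open>In \<open>us\<close> the \<open>?n\<close> guessed values come first, then
    \<open>t\<close> at position \<open>?n\<close>, the result at \<open>?n + 1\<close>, and the
    arguments.\<close>
  have "ode_rel (?n + (p + 2)) (\<lambda>us. Qg (gs ! i) (us ! ?n # us ! i # drop (?n + 2) us))" if "i < ?n" for i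
    using ode_rel_subst[of "p + 2" "Qg (gs ! i)" "[\<lambda>us. us ! ?n, \<lambda>us. us ! i]" p "?n + 2" "?n + (p + 2)"]
      gsi[OF that] that by (simp add: confirms_def ode.proj)
  moreover have "ode_rel (?n + (p + 2)) (\<lambda>us. Qf (us ! ?n # us ! (?n + 1) # take ?n us))"
  proof -
    have "ode_rel (?n + (p + 2)) (\<lambda>us. Qf (us ! ?n # us ! (?n + 1) #
        map (\<lambda>i. us ! i) [0..<?n] @ drop (?n + (p + 2)) us))"
      using ode_rel_subst[of "?n + 2" Qf "(\<lambda>us. us ! ?n) # (\<lambda>us. us ! (?n + 1)) # map (\<lambda>i us. us ! i) [0..<?n]"
          0 "?n + (p + 2)" "?n + (p + 2)"] f
      by (simp add: confirms_def comp_def ode.proj list_all_iff)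
    then show ?thesis
    proof (rule ode_rel_cong)
      fix us :: "nat list" assume us: "length us = ?n + (p + 2)"
      then have "map (\<lambda>i. us ! i) [0..<?n] = take ?n us"
        by (intro nth_equalityI) auto
      with us show "Qf (us ! ?n # us ! (?n + 1) # map (\<lambda>i. us ! i) [0..<?n] @ drop (?n + (p + 2)) us) =
          Qf (us ! ?n # us ! (?n + 1) # take ?n us)"
        by simp
    qed
  qed
  ultimately have "ode_rel (?n + (p + 2)) (\<lambda>us. (\<forall>i<?n. Qg (gs ! i) (us ! ?n # us ! i # drop (?n + 2) us)) \<and>
      Qf (us ! ?n # us ! (?n + 1) # take ?n us))"
    by (intro ode_rel_conj ode_rel_ball_lessThan)
  from ode_rel_ex_list[OF this ode.proj[of 0]] have "ode_rel (p + 2) ?Q"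
    by (rule ode_rel_cong) (auto simp: nth_append intro!: ex_cong1)
  moreover have "comp_partial p f gs xs = Some v" if xs: "length xs = p" and Q: "?Q (t # v # xs)" for t v xs
  proof -
    from Q obtain vs where vs: "length vs = ?n" "\<And>i. i < ?n \<Longrightarrow> Qg (gs ! i) (t # vs ! i # xs)" "Qf (t # v # vs)"
      by auto
    have val: "(gs ! i) xs = Some (vs ! i)" if "i < ?n" for i
      using gsi[OF that] vs(2)[OF that] xs by (auto simp: confirms_def)
    have "map (\<lambda>g. the (g xs)) gs = vs"
      using vs(1) val by (intro nth_equalityI) auto
    moreover have "f vs = Some v"
      using f vs by (auto simp: confirms_def)
    moreover have "\<forall>g\<in>set gs. g xs \<noteq> None"
      using val by (auto simp: in_set_conv_nth)
    ultimately show ?thesis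
      using xs by (simp add: comp_partial_def)
  qed
  moreover have "\<forall>\<^sub>F t in sequentially. ?Q (t # v # xs)"
    if xs: "length xs = p" and v: "comp_partial p f gs xs = Some v" for v xs
  proof -
    define vs where "vs = map (\<lambda>g. the (g xs)) gs"
    have def: "\<forall>g\<in>set gs. g xs \<noteq> None" and fv: "f vs = Some v"
      using v by (auto simp: comp_partial_def vs_def split: if_splits)
    have val: "(gs ! i) xs = Some (vs ! i)" if "i < ?n" for i
      using def that by (auto simp: vs_def)
    \<comment> \<open>Finitely many conditions that each hold for all large \<open>t\<close> hold
      simultaneously for all large \<open>t\<close>. This is why \<open>confirms\<close> demands
      eventual truth instead of truth for some \<open>t\<close>.\<close>
    have "\<forall>\<^sub>F t in sequentially. \<forall>i\<in>{..<?n}. Qg (gs ! i) (t # vs ! i # xs)"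
      by (rule eventually_ball_finite) (use gsi val xs in \<open>auto simp: confirms_def\<close>)
    moreover have "\<forall>\<^sub>F t in sequentially. \<forall>v\<in>set vs. v < t"
      by (rule eventually_ball_finite) (auto intro: eventually_gt_at_top)
    moreover have "\<forall>\<^sub>F t in sequentially. Qf (t # v # vs)"
      using f fv by (auto simp: confirms_def vs_def)
    ultimately show ?thesis
    proof eventually_elim
      case (elim t)
      then show ?case by (intro exI[of _ vs]) (auto simp: vs_def)
    qed
  qed
  ultimately show ?thesis
    by (simp only: confirms_def) blast
qed

text \<open>The trace is guessed as a base parameter \<open>b\<close> and a number \<open>c\<close>
  below \<open>t\<close>, and each of its steps is confirmed by \<open>t\<close>. Position 2 of
  \<open>zs\<close> is the recursion argument.\<close>

lemma confirms_prim_rec: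
  assumes g: "confirms p Qg g" and h: "confirms (p + 2) Qh h"
  shows "confirms (p + 1) (\<lambda>zs. \<exists>b<zs ! 0. \<exists>c<zs ! 0. digit b c (zs ! 2) = zs ! 1 \<and>
      Qg (zs ! 0 # digit b c 0 # drop 3 zs) \<and>
      (\<forall>i<zs ! 2. Qh (zs ! 0 # digit b c (Suc i) # i # digit b c i # drop 3 zs))) (prim_rec g h)"
    (is "confirms _ ?Q _")
proof -
  \<comment> \<open>\<open>us\<close> lists \<open>c\<close>, \<open>b\<close>, \<open>t\<close>,
    the result, the recursion argument and the parameters; \<open>ws\<close> has the step index in
    front of these.\<close>
  have "ode_rel (p + 5) (\<lambda>us. Qg (us ! 2 # digit (us ! 1) (us ! 0) 0 # drop 5 us))"
    using ode_rel_subst[of "p + 2" Qg "[\<lambda>us. us ! 2, \<lambda>us. digit (us ! 1) (us ! 0) 0]" p 5 "p + 5"] g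
    by (simp add: confirms_def ode.proj ode_digit ode.const)
  moreover have "ode_rel (Suc (p + 5)) (\<lambda>ws. Qh (ws ! 3 # digit (ws ! 2) (ws ! 1) (Suc (ws ! 0)) # ws ! 0 #
      digit (ws ! 2) (ws ! 1) (ws ! 0) # drop 6 ws))"
    using ode_rel_subst[of "p + 2 + 2" Qh "[\<lambda>ws. ws ! 3, \<lambda>ws. digit (ws ! 2) (ws ! 1) (Suc (ws ! 0)), \<lambda>ws. ws ! 0,
      \<lambda>ws. digit (ws ! 2) (ws ! 1) (ws ! 0)]" p 6 "Suc (p + 5)"] h
    by (simp add: confirms_def ode.proj ode_digit ode.Suc)
  from ode_rel_all_less[OF this ode.proj[of 4]]
  have "ode_rel (p + 5) (\<lambda>us. \<forall>i<us ! 4. Qh (us ! 2 # digit (us ! 1) (us ! 0) (Suc i) # i #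
      digit (us ! 1) (us ! 0) i # drop 5 us))"
    by (simp add: eval_nat_numeral)
  moreover have "ode_rel (p + 5) (\<lambda>us. digit (us ! 1) (us ! 0) (us ! 4) = us ! 3)"
    by (intro ode_rel_eq ode_digit ode.proj) auto
  ultimately have "ode_rel (Suc (Suc (p + 3))) (\<lambda>us. digit (us ! 1) (us ! 0) (us ! 4) = us ! 3 \<and>
      Qg (us ! 2 # digit (us ! 1) (us ! 0) 0 # drop 5 us) \<and>
      (\<forall>i<us ! 4. Qh (us ! 2 # digit (us ! 1) (us ! 0) (Suc i) # i # digit (us ! 1) (us ! 0) i # drop 5 us)))"
    by (simp add: ode_rel_conj eval_nat_numeral)
  from ode_rel_ex_less[OF ode_rel_ex_less[OF this ode.proj[of 1]] ode.proj[of 0]]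
  have "ode_rel (p + 1 + 2) ?Q"
    by (simp add: eval_nat_numeral)
  moreover have "prim_rec g h xs = Some v" if xs: "length xs = p + 1" and Q: "?Q (t # v # xs)" for t v xs
  proof -
    from xs obtain x ys where [simp]: "xs = x # ys" "length ys = p"
      by (cases xs) auto
    from Q obtain b c where "digit b c x = v" "Qg (t # digit b c 0 # ys)"
      "\<forall>i<x. Qh (t # digit b c (Suc i) # i # digit b c i # ys)"
      by (auto simp: eval_nat_numeral)
    then show ?thesis
      using g h by (auto simp: confirms_def prim_rec_eq_Some_iff intro!: exI[of _ "digit b c"])
  qed
  moreover have "\<forall>\<^sub>F t in sequentially. ?Q (t # v # xs)"
    if xs: "length xs = p + 1" and v: "prim_rec g h xs = Some v" for v xs
  proof -
    from xs obtain x ys where [simp]: "xs = x # ys" "length ys = p"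
      by (cases xs) auto
    from v obtain r where r: "g ys = Some (r 0)" "\<And>i. i < x \<Longrightarrow> h (i # r i # ys) = Some (r (Suc i))" "r x = v"
      by (auto simp: prim_rec_eq_Some_iff)
    \<comment> \<open>Digits range up to \<open>b\<close>, so the largest value of the trace is a
      suitable \<open>b\<close>.\<close>
    define b where "b = Max (r ` {..x})"
    obtain c where c: "\<forall>i<Suc x. digit b c i = r i"
      using ex_digits[of "Suc x" r b] by (auto simp: b_def less_Suc_eq_le)
    have "\<forall>\<^sub>F t in sequentially. \<forall>i\<in>{..<x}. Qh (t # r (Suc i) # i # r i # ys)"
      by (rule eventually_ball_finite) (use h r in \<open>auto simp: confirms_def\<close>)
    moreover have "\<forall>\<^sub>F t in sequentially. Qg (t # r 0 # ys)"
      using g r by (auto simp: confirms_def)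
    ultimately show ?thesis
      using eventually_gt_at_top[of b] eventually_gt_at_top[of c]
    proof eventually_elim
      case (elim t)
      then show ?case
        using c r by (intro exI[of _ b] exI[of _ c] conjI) (auto simp: eval_nat_numeral)
    qed
  qed
  ultimately show ?thesis
    by (simp only: confirms_def) blast
qed

text \<open>That the value at a smaller \<open>z\<close> is nonzero must be stated positively, as a
  confirmed \<open>Suc u\<close>: a failure to confirm 0 may only mean that \<open>t\<close> is too
  small or that \<open>f\<close> is undefined there.\<close>

lemma confirms_minimization:
  assumes f: "confirms (p + 1) Qf f"
  shows "confirms p (\<lambda>zs. Qf (zs ! 0 # 0 # zs ! 1 # drop 2 zs) \<and>
    (\<forall>z<zs ! 1. \<exists>u<zs ! 0. Qf (zs ! 0 # Suc u # z # drop 2 zs))) (minimization f)"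
    (is "confirms _ ?Q _")
proof -
  have "ode_rel (p + 2) (\<lambda>zs. Qf (zs ! 0 # 0 # zs ! 1 # drop 2 zs))"
    using ode_rel_subst[of "p + 3" Qf "[\<lambda>zs. zs ! 0, \<lambda>zs. 0, \<lambda>zs. zs ! 1]" p 2 "p + 2"] f
    by (simp add: confirms_def ode.proj ode.const numeral_3_eq_3)
  moreover have "ode_rel (Suc (Suc (p + 2))) (\<lambda>us. Qf (us ! 2 # Suc (us ! 0) # us ! 1 # drop 4 us))"
    using ode_rel_subst[of "p + 3" Qf "[\<lambda>us. us ! 2, \<lambda>us. Suc (us ! 0), \<lambda>us. us ! 1]" p 4 "Suc (Suc (p + 2))"] f
    by (simp add: confirms_def ode.proj ode.Suc numeral_3_eq_3)
  from ode_rel_all_less[OF ode_rel_ex_less[OF this ode.proj[of 1]] ode.proj[of 1]]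
  have "ode_rel (p + 2) (\<lambda>zs. \<forall>z<zs ! 1. \<exists>u<zs ! 0. Qf (zs ! 0 # Suc u # z # drop 2 zs))"
    by (simp add: eval_nat_numeral)
  ultimately have "ode_rel (p + 2) ?Q"
    by (rule ode_rel_conj)
  moreover have "minimization f ys = Some v" if ys: "length ys = p" and Q: "?Q (t # v # ys)" for t v ys
  proof -
    have val: "f (v # ys) = Some 0" and less: "\<And>z. z < v \<Longrightarrow> \<exists>u. f (z # ys) = Some (Suc u)"
      using Q f ys by (fastforce simp: confirms_def)+
    have "(LEAST x. f (x # ys) = Some 0 \<and> (\<forall>z<x. f (z # ys) \<noteq> None)) = v"
      by (rule Least_equality) (use val less in \<open>force simp: not_less[symmetric]\<close>)+
    then show ?thesis
      using val less by (force simp: minimization_def Let_def)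
  qed
  moreover have "\<forall>\<^sub>F t in sequentially. ?Q (t # v # ys)"
    if ys: "length ys = p" and v: "minimization f ys = Some v" for v ys
  proof -
    let ?P = "\<lambda>x. f (x # ys) = Some 0 \<and> (\<forall>z<x. f (z # ys) \<noteq> None)"
    have ex: "\<exists>x. ?P x" and least: "v = (LEAST x. ?P x)"
      using v by (auto simp: minimization_def Let_def split: if_splits)
    have P: "?P v"
      unfolding least by (rule LeastI_ex[OF ex])
    have "\<exists>u. f (z # ys) = Some (Suc u)" if z: "z < v" for z
    proof -
      obtain w where w: "f (z # ys) = Some w" using P z by blast
      \<comment> \<open>If \<open>w\<close> were 0, then \<open>z\<close> would satisfy
        \<open>?P\<close>, since \<open>f\<close> is defined everywhere below \<open>v\<close>; this
        contradicts the minimality of \<open>v\<close>.\<close>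
      have "w \<noteq> 0"
        using not_less_Least[of z ?P] z P w unfolding least[symmetric] by auto
      with w show ?thesis by (auto simp: gr0_conv_Suc)
    qed
    then obtain u where u: "\<And>z. z < v \<Longrightarrow> f (z # ys) = Some (Suc (u z))" by metis
    have "\<forall>\<^sub>F t in sequentially. \<forall>z\<in>{..<v}. Qf (t # Suc (u z) # z # ys) \<and> u z < t"
      by (rule eventually_ball_finite)
        (use f u ys in \<open>auto simp: confirms_def intro!: eventually_conj eventually_gt_at_top\<close>)
    moreover have "\<forall>\<^sub>F t in sequentially. Qf (t # 0 # v # ys)"
      using f P ys by (auto simp: confirms_def)
    ultimately show ?thesis
      by eventually_elim auto
  qed
  ultimately show ?thesis
    by (simp only: confirms_def) blast
qed

lemma partial_recursive_confirmed: "partial_recursive p f \<Longrightarrow> \<exists>Q. confirms p Q f"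
proof (induction rule: partial_recursive.induct)
  case (zero p)
  have "ode_rel (p + 2) (\<lambda>zs. zs ! 1 = 0)"
    by (intro ode_rel_eq ode.proj ode.const) auto
  then show ?case
    by (intro exI[of _ "\<lambda>zs. zs ! 1 = 0"]) (auto simp: confirms_def in_nlists_UNIV)
next
  case (proj i p)
  have "ode_rel (p + 2) (\<lambda>zs. zs ! 1 = zs ! (i + 2))"
    by (intro ode_rel_eq ode.proj) (use proj in auto)
  then show ?case
    by (intro exI[of _ "\<lambda>zs. zs ! 1 = zs ! (i + 2)"]) (auto simp: confirms_def in_nlists_UNIV)
next
  case succ
  have "ode_rel (1 + 2) (\<lambda>zs. zs ! 1 = Suc (zs ! 2))"
    by (intro ode_rel_eq ode.proj ode.Suc) auto
  then show ?case
    by (intro exI[of _ "\<lambda>zs. zs ! 1 = Suc (zs ! 2)"])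
      (auto simp: confirms_def in_nlists_UNIV eval_nat_numeral)
next
  case (comp gs f p)
  then obtain Qg where "\<And>g. g \<in> set gs \<Longrightarrow> confirms p (Qg g) g" by metis
  with comp show ?case using confirms_comp by blast
next
  case (prec p g h)
  then show ?case using confirms_prim_rec by blast
next
  case (mini p f)
  then show ?case using confirms_minimization by blast
qed

section \<open>Values of total functions by two successive searches\<close>

lemma ode_total_recursive:
  assumes f: "partial_recursive p f" and dom: "dom f = nlists p UNIV"
  shows "ode p (\<lambda>xs. the (f xs))"
proof -
  obtain Q where Q: "ode_rel (p + 2) Q"
    and sound: "\<And>t v xs. length xs = p \<Longrightarrow> Q (t # v # xs) \<Longrightarrow> f xs = Some v"
    and complete: "\<And>v xs. length xs = p \<Longrightarrow> f xs = Some v \<Longrightarrow> \<forall>\<^sub>F t in sequentially. Q (t # v # xs)"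
    using partial_recursive_confirmed[OF f] by (auto simp: confirms_def)
  \<comment> \<open>The bound \<open>v < t\<close> makes the search condition decidable. Totality of
    \<open>f\<close> makes the search safe, since a large \<open>t\<close> both confirms and exceeds
    the value.\<close>
  define s where "s xs = (LEAST t. \<exists>v<t. Q (t # v # xs))" for xs
  have ex: "\<exists>t. \<exists>v<t. Q (t # v # xs)" if xs: "length xs = p" for xs
  proof -
    have "xs \<in> dom f" using xs dom by (simp add: in_nlists_UNIV)
    then obtain v where "f xs = Some v" by blast
    from eventually_conj[OF complete[OF xs this] eventually_gt_at_top[of v]] show ?thesis
      by (auto simp: eventually_sequentially)
  qed
  have "ode_rel (Suc (Suc p)) (\<lambda>us. Q (us ! 1 # us ! 0 # drop 2 us))"
    using ode_rel_subst[OF Q, of "[\<lambda>us. us ! 1, \<lambda>us. us ! 0]" p 2 "Suc (Suc p)"]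
    by (simp add: ode.proj)
  from ode_LEAST[OF ode_rel_ex_less[OF this ode.proj[of 0]]] ex have "ode p s"
    unfolding s_def by (simp add: eval_nat_numeral)
  then have "ode (Suc p) (\<lambda>zs. s (drop 1 zs))"
    by (rule ode.weaken) simp
  then have rel: "ode_rel (Suc p) (\<lambda>zs. Q (s (drop 1 zs) # zs ! 0 # drop 1 zs))"
    using ode_rel_subst[OF Q, of "[\<lambda>zs. s (drop 1 zs), \<lambda>zs. zs ! 0]" p 1 "Suc p"]
    by (simp add: ode.proj)
  have ex_value: "\<exists>v. Q (s xs # v # xs)" if "length xs = p" for xs
    using LeastI_ex[OF ex[OF that]] unfolding s_def by blast
  \<comment> \<open>By soundness the only \<open>v\<close> confirmed by \<open>s xs\<close> is the
    value of \<open>f\<close>, so the least one is this value.\<close>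
  have "ode p (\<lambda>xs. LEAST v. Q (s xs # v # xs))"
    using ode_LEAST[OF rel] ex_value by simp
  then show ?thesis
  proof (rule ode.cong)
    fix xs :: "nat list" assume xs: "length xs = p"
    show "(LEAST v. Q (s xs # v # xs)) = the (f xs)"
      using sound[OF xs LeastI_ex[OF ex_value[OF xs]]] by simp
  qed
qed

lemma int_fun_eq_restrict:
  assumes "dom f = nlists p UNIV"
  shows "int_fun f = (\<lambda>xs. Some (int (the (f (map nat xs))))) |` nlists p \<nat>"
proof
  fix xs :: "int list"
  have "map nat xs \<notin> dom f \<longleftrightarrow> length xs \<noteq> p"
    unfolding assms by (simp add: in_nlists_UNIV)
  then show "int_fun f xs = ((\<lambda>xs. Some (int (the (f (map nat xs))))) |` nlists p \<nat>) xs"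
    by (auto simp: int_fun_def in_nlists_iff restrict_map_def)
qed

section \<open>Total recursive functions as a clone\<close>

definition recursive :: "nat \<Rightarrow> (nat list \<Rightarrow> nat) \<Rightarrow> bool" where
  "recursive p F \<longleftrightarrow> partial_recursive p ((\<lambda>xs. Some (F xs)) |` nlists p UNIV)"

lemma recursive_comp:
  assumes F: "recursive (length Gs) F" and Gs: "\<And>G. G \<in> set Gs \<Longrightarrow> recursive p G"
  shows "recursive p (\<lambda>xs. F (map (\<lambda>G. G xs) Gs))"
proof -
  let ?m = "\<lambda>p F. (\<lambda>xs. Some (F xs)) |` nlists p UNIV"
  have "partial_recursive p (comp_partial p (?m (length Gs) F) (map (?m p) Gs))"
    by (rule partial_recursive.comp) (use F Gs in \<open>auto simp: recursive_def\<close>)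
  also have "comp_partial p (?m (length Gs) F) (map (?m p) Gs) = ?m p (\<lambda>xs. F (map (\<lambda>G. G xs) Gs))"
    by (rule ext) (auto simp: comp_partial_def in_nlists_UNIV restrict_map_def comp_def)
  finally show ?thesis
    by (simp add: recursive_def)
qed

lemma recursive_cong:
  "recursive p F \<Longrightarrow> (\<And>xs. length xs = p \<Longrightarrow> F xs = F' xs) \<Longrightarrow> recursive p F'"
  unfolding recursive_def
  using restrict_map_cong[of "nlists p UNIV" "\<lambda>xs. Some (F xs)" "\<lambda>xs. Some (F' xs)"]
  by (simp add: in_nlists_UNIV)

lemma clone_recursive: "clone recursive"
  apply (rule clone.intro)
  subgoal for p F F' by (rule recursive_cong[of p F F'])
  subgoal by (simp add: recursive_def partial_recursive.proj)
  subgoal for Gs F p using recursive_comp[of Gs F p] by simp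
  subgoal by (simp add: recursive_def partial_recursive.zero)
  subgoal unfolding recursive_def by (rule partial_recursive.succ)
  done

interpretation rec: clone recursive
  by (rule clone_recursive)

lemma recursive_prim_rec:
  assumes G: "recursive p G" and H: "recursive (p + 2) H"
    and F0: "\<And>ys. length ys = p \<Longrightarrow> F (0 # ys) = G ys"
    and FS: "\<And>x ys. length ys = p \<Longrightarrow> F (Suc x # ys) = H (x # F (x # ys) # ys)"
  shows "recursive (Suc p) F"
proof -
  let ?m = "\<lambda>p F. (\<lambda>xs. Some (F xs)) |` nlists p UNIV"
  have "prim_rec (?m p G) (?m (p + 2) H) (x # ys) = ?m (Suc p) F (x # ys)" for x and ys :: "nat list"
    by (induction x) (auto simp: restrict_map_def in_nlists_UNIV F0 FS split: option.splits)
  then have "prim_rec (?m p G) (?m (p + 2) H) xs = ?m (Suc p) F xs" for xs :: "nat list"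
    by (cases xs) (auto simp: restrict_map_def in_nlists_UNIV)
  then have "prim_rec (?m p G) (?m (p + 2) H) = ?m (Suc p) F" by blast
  then show ?thesis
    using partial_recursive.prec G H by (fastforce simp: recursive_def)
qed

lemma recursive_LEAST:
  assumes F: "recursive (Suc p) F" and ex: "\<And>xs. length xs = p \<Longrightarrow> \<exists>n. F (n # xs) = 0"
  shows "recursive p (\<lambda>xs. LEAST n. F (n # xs) = 0)"
proof -
  let ?f = "(\<lambda>xs. Some (F xs)) |` nlists (p + 1) UNIV"
  have "partial_recursive p (minimization ?f)"
    by (rule partial_recursive.mini) (use F in \<open>simp add: recursive_def\<close>)
  also have "minimization ?f = (\<lambda>xs. Some (LEAST n. F (n # xs) = 0)) |` nlists p UNIV"
    using ex by (auto simp: minimization_def Let_def restrict_map_def in_nlists_UNIV fun_eq_iff)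
  finally show ?thesis
    by (simp add: recursive_def)
qed

subsection \<open>Arithmetic and pairing\<close>

lemma recursive_add: "recursive p F \<Longrightarrow> recursive p G \<Longrightarrow> recursive p (\<lambda>xs. F xs + G xs)"
proof (rule rec.comp2[of "(+)"])
  show "recursive 2 (\<lambda>xs. xs ! 0 + xs ! 1)"
    unfolding numeral_2_eq_2
    by (rule recursive_prim_rec[where G = "\<lambda>xs. xs ! 0" and H = "\<lambda>xs. Suc (xs ! 1)"])
      (auto intro: rec.proj rec.Suc)
qed

lemma recursive_mult: "recursive p F \<Longrightarrow> recursive p G \<Longrightarrow> recursive p (\<lambda>xs. F xs * G xs)"
proof (rule rec.comp2[of "(*)"])
  show "recursive 2 (\<lambda>xs. xs ! 0 * xs ! 1)"
    unfolding numeral_2_eq_2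
    by (rule recursive_prim_rec[where G = "\<lambda>xs. 0" and H = "\<lambda>xs. xs ! 1 + xs ! 2"])
      (intro recursive_add rec.proj rec.const | simp)+
qed

lemma recursive_pred: "recursive p F \<Longrightarrow> recursive p (\<lambda>xs. F xs - 1)"
proof (rule rec.comp1[of "\<lambda>x. x - 1"])
  show "recursive 1 (\<lambda>xs. xs ! 0 - 1)"
    unfolding One_nat_def
    by (rule recursive_prim_rec[where G = "\<lambda>xs. 0" and H = "\<lambda>xs. xs ! 0"])
      (auto intro: rec.proj rec.const)
qed

text \<open>Recursion acts on the first argument, so the subtrahend is placed there and counts how
  often the predecessor is applied.\<close>

lemma recursive_diff: "recursive p F \<Longrightarrow> recursive p G \<Longrightarrow> recursive p (\<lambda>xs. F xs - G xs)"
proof (rule rec.comp2[of "\<lambda>x y. y - x" p G F])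
  show "recursive 2 (\<lambda>xs. xs ! 1 - xs ! 0)"
    unfolding numeral_2_eq_2
    by (rule recursive_prim_rec[where G = "\<lambda>xs. xs ! 0" and H = "\<lambda>xs. xs ! 1 - 1"])
      (auto intro: rec.proj recursive_pred[simplified])
qed

lemma recursive_triangle: "recursive p F \<Longrightarrow> recursive p (\<lambda>xs. triangle (F xs))"
proof (rule rec.comp1[of triangle])
  show "recursive 1 (\<lambda>xs. triangle (xs ! 0))"
    unfolding One_nat_def
    by (rule recursive_prim_rec[where G = "\<lambda>xs. 0" and H = "\<lambda>xs. xs ! 1 + Suc (xs ! 0)"])
      (intro recursive_add rec.Suc rec.proj rec.const | simp)+
qed

lemma recursive_prod_encode:
  "recursive p F \<Longrightarrow> recursive p G \<Longrightarrow> recursive p (\<lambda>xs. prod_encode (F xs, G xs))"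
  by (simp add: prod_encode_def recursive_add recursive_triangle)

lemma triangle_mono: "a \<le> b \<Longrightarrow> triangle a \<le> triangle b"
  unfolding triangle_def by (intro div_le_mono mult_le_mono) simp_all

text \<open>\<open>prod_encode (a, b)\<close> is \<open>triangle (a + b) + a\<close>, hence below
  \<open>triangle (Suc (a + b))\<close>. The truncated difference vanishes iff the code is below
  \<open>triangle (Suc t)\<close>, so the least such \<open>t\<close> is the index of the
  diagonal.\<close>

lemma LEAST_triangle: "(LEAST t. Suc (prod_encode (a, b)) - triangle (Suc t) = 0) = a + b"
proof (rule Least_equality)
  show "Suc (prod_encode (a, b)) - triangle (Suc (a + b)) = 0"
    by (simp add: prod_encode_def)
  show "a + b \<le> t" if "Suc (prod_encode (a, b)) - triangle (Suc t) = 0" for t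
  proof (rule ccontr)
    assume "\<not> a + b \<le> t"
    then have "triangle (Suc t) \<le> triangle (a + b)" by (intro triangle_mono) simp
    with that show False by (simp add: prod_encode_def)
  qed
qed

lemma recursive_prod_decode:
  assumes F: "recursive p F"
  shows "recursive p (\<lambda>xs. fst (prod_decode (F xs)))" "recursive p (\<lambda>xs. snd (prod_decode (F xs)))"
proof -
  \<comment> \<open>\<open>?root z\<close> is the diagonal of \<open>z\<close>; the offset on it is
    the first component, and the rest of \<open>?root z\<close> is the second.\<close>
  let ?root = "\<lambda>z. LEAST t. Suc z - triangle (Suc t) = 0"
  have root: "?root z = fst (prod_decode z) + snd (prod_decode z)"
    and fst: "fst (prod_decode z) = z - triangle (?root z)"
    and snd: "snd (prod_decode z) = ?root z - (z - triangle (?root z))" for z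
  proof -
    obtain a b where "z = prod_encode (a, b)"
      by (metis prod_decode_inverse surj_pair)
    then show "?root z = fst (prod_decode z) + snd (prod_decode z)"
      "fst (prod_decode z) = z - triangle (?root z)"
      "snd (prod_decode z) = ?root z - (z - triangle (?root z))"
      by (simp_all only: LEAST_triangle prod_encode_inverse fst_conv snd_conv) (simp_all add: prod_encode_def)
  qed
  have "recursive (Suc p) (\<lambda>xs. Suc (F (drop 1 xs)) - triangle (Suc (xs ! 0)))"
    by (intro recursive_diff recursive_triangle rec.Suc rec.proj rec.weaken[OF F]) auto
  moreover have "\<exists>t. Suc z - triangle (Suc t) = 0" for z
    by (intro exI[of _ z]) simp
  ultimately have R: "recursive p (\<lambda>xs. ?root (F xs))"
    using recursive_LEAST[of p "\<lambda>xs. Suc (F (drop 1 xs)) - triangle (Suc (xs ! 0))"] by simp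
  show "recursive p (\<lambda>xs. fst (prod_decode (F xs)))" "recursive p (\<lambda>xs. snd (prod_decode (F xs)))"
    unfolding fst snd by (intro recursive_diff recursive_triangle F R)+
qed

subsection \<open>Simultaneous primitive recursion\<close>

text \<open>Nested pairs closed by 0. Decoding is told the length from outside.\<close>

definition tuple_encode :: "nat list \<Rightarrow> nat" where
  "tuple_encode xs = foldr (\<lambda>x c. prod_encode (x, c)) xs 0"

definition component :: "nat \<Rightarrow> nat \<Rightarrow> nat" where
  "component j c = fst (prod_decode (((\<lambda>c. snd (prod_decode c)) ^^ j) c))"

lemma component_tuple_encode: "j < length xs \<Longrightarrow> component j (tuple_encode xs) = xs ! j"
proof (induction xs arbitrary: j)
  case (Cons x xs)
  then show ?case
    by (cases j) (auto simp: component_def tuple_encode_def funpow_swap1 simp del: funpow.simps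
      simp: funpow_Suc_right)
qed simp

lemma map_component_tuple_encode: "map (\<lambda>j. component j (tuple_encode xs)) [0..<length xs] = xs"
  by (rule nth_equalityI) (auto simp: component_tuple_encode)

lemma recursive_component: "recursive p F \<Longrightarrow> recursive p (\<lambda>xs. component j (F xs))"
proof -
  assume F: "recursive p F"
  have "recursive p (\<lambda>xs. ((\<lambda>c. snd (prod_decode c)) ^^ j) (F xs))"
    by (induction j) (auto intro: F recursive_prod_decode)
  then show ?thesis
    unfolding component_def by (rule recursive_prod_decode)
qed

lemma recursive_tuple_encode:
  "(\<And>i. i < k \<Longrightarrow> recursive p (F i)) \<Longrightarrow> recursive p (\<lambda>xs. tuple_encode (map (\<lambda>i. F i xs) [0..<k]))"
proof -
  assume F: "\<And>i. i < k \<Longrightarrow> recursive p (F i)"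
  have "recursive p (\<lambda>xs. tuple_encode (map (\<lambda>i. F i xs) is))" if "set is \<subseteq> {..<k}" for "is"
    using that by (induction "is") (auto simp: tuple_encode_def intro: rec.const recursive_prod_encode F)
  from this[of "[0..<k]"] show ?thesis by (simp add: atLeast0LessThan)
qed

text \<open>The state vector is packed into one number, so ordinary primitive recursion applies.
  Each step unpacks it into \<open>k\<close> arguments for the functions \<open>H i\<close> and
  packs their results again.\<close>

lemma recursive_simultaneous:
  fixes V :: "nat \<Rightarrow> nat list \<Rightarrow> nat list"
  assumes G: "\<And>i. i < k \<Longrightarrow> recursive p (G i)" and H: "\<And>i. i < k \<Longrightarrow> recursive (Suc (k + p)) (H i)"
    and V0: "\<And>ys. length ys = p \<Longrightarrow> V 0 ys = map (\<lambda>i. G i ys) [0..<k]"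
    and VS: "\<And>x ys. length ys = p \<Longrightarrow> V (Suc x) ys = map (\<lambda>i. H i (x # V x ys @ ys)) [0..<k]"
    and i: "i < k"
  shows "recursive (Suc p) (\<lambda>xs. V (xs ! 0) (drop 1 xs) ! i)"
proof -
  have len: "length (V x ys) = k" if "length ys = p" for x and ys :: "nat list"
    using that by (cases x) (auto simp: V0 VS)
  have "recursive (Suc p) (\<lambda>xs. tuple_encode (V (xs ! 0) (drop 1 xs)))"
  proof (rule recursive_prim_rec)
    show "recursive p (\<lambda>ys. tuple_encode (map (\<lambda>i. G i ys) [0..<k]))"
      by (rule recursive_tuple_encode[OF G])
    have "recursive (p + 2) (\<lambda>zs. H i (zs ! 0 # map (\<lambda>j. component j (zs ! 1)) [0..<k] @ drop 2 zs))"
      if "i < k" for i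
    proof -
      have "recursive (p + 2) (\<lambda>zs. H i (map (\<lambda>G. G zs) ((\<lambda>zs. zs ! 0) #
          map (\<lambda>j zs. component j (zs ! 1)) [0..<k]) @ drop 2 zs))"
        by (rule rec.subst[OF H[OF that]]) (auto intro: rec.proj recursive_component)
      then show ?thesis by (simp add: comp_def)
    qed
    then show "recursive (p + 2) (\<lambda>zs. tuple_encode (map (\<lambda>i. H i (zs ! 0 #
        map (\<lambda>j. component j (zs ! 1)) [0..<k] @ drop 2 zs)) [0..<k]))"
      by (rule recursive_tuple_encode)
  next
    fix x and ys :: "nat list" assume ys: "length ys = p"
    have "map (\<lambda>j. component j (tuple_encode (V x ys))) [0..<k] = V x ys"
      using map_component_tuple_encode[of "V x ys"] len[OF ys] by simp
    then show "tuple_encode (V ((Suc x # ys) ! 0) (drop 1 (Suc x # ys))) =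
      tuple_encode (map (\<lambda>i. H i ((x # tuple_encode (V ((x # ys) ! 0) (drop 1 (x # ys))) # ys) ! 0 #
        map (\<lambda>j. component j ((x # tuple_encode (V ((x # ys) ! 0) (drop 1 (x # ys))) # ys) ! 1)) [0..<k] @
        drop 2 (x # tuple_encode (V ((x # ys) ! 0) (drop 1 (x # ys))) # ys))) [0..<k])"
      using ys by (simp add: VS)
  qed (simp add: V0)
  from recursive_component[OF this, of i] show ?thesis
    by (rule recursive_cong) (use len i in \<open>simp add: component_tuple_encode\<close>)
qed

section \<open>Functions generated by linear ODEs and safe minimization are recursive\<close>

definition decode :: "nat \<Rightarrow> int" where
  "decode c = int (fst (prod_decode c)) - int (snd (prod_decode c))"

definition code_nat :: "nat \<Rightarrow> nat" where
  "code_nat n = prod_encode (n, 0)"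

definition code_add :: "nat \<Rightarrow> nat \<Rightarrow> nat" where
  "code_add c d = prod_encode (fst (prod_decode c) + fst (prod_decode d), snd (prod_decode c) + snd (prod_decode d))"

definition code_diff :: "nat \<Rightarrow> nat \<Rightarrow> nat" where
  "code_diff c d = prod_encode (fst (prod_decode c) + snd (prod_decode d), snd (prod_decode c) + fst (prod_decode d))"

definition code_mult :: "nat \<Rightarrow> nat \<Rightarrow> nat" where
  "code_mult c d =
     prod_encode (fst (prod_decode c) * fst (prod_decode d) + snd (prod_decode c) * snd (prod_decode d),
       fst (prod_decode c) * snd (prod_decode d) + snd (prod_decode c) * fst (prod_decode d))"

definition code_sum :: "nat list \<Rightarrow> nat" where
  "code_sum cs = foldr code_add cs (code_nat 0)"

lemma decode_code [simp]:
  "decode (code_nat n) = int n"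
  "decode (code_add c d) = decode c + decode d"
  "decode (code_diff c d) = decode c - decode d"
  "decode (code_mult c d) = decode c * decode d"
  by (auto simp: decode_def code_nat_def code_add_def code_diff_def code_mult_def algebra_simps)

lemma decode_code_sum [simp]: "decode (code_sum cs) = sum_list (map decode cs)"
  by (induction cs) (auto simp: code_sum_def)

lemma recursive_code_nat: "recursive p F \<Longrightarrow> recursive p (\<lambda>xs. code_nat (F xs))"
  unfolding code_nat_def by (intro recursive_prod_encode rec.const)

lemma recursive_code:
  assumes "recursive p F" "recursive p G"
  shows "recursive p (\<lambda>xs. code_add (F xs) (G xs))"
    "recursive p (\<lambda>xs. code_diff (F xs) (G xs))"
    "recursive p (\<lambda>xs. code_mult (F xs) (G xs))"
  unfolding code_add_def code_diff_def code_mult_def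
  by (intro recursive_prod_encode recursive_add recursive_mult recursive_prod_decode rec.const assms)+

lemma recursive_code_sum:
  "(\<And>i. i < k \<Longrightarrow> recursive p (F i)) \<Longrightarrow> recursive p (\<lambda>xs. code_sum (map (\<lambda>i. F i xs) [0..<k]))"
proof -
  assume F: "\<And>i. i < k \<Longrightarrow> recursive p (F i)"
  have "recursive p (\<lambda>xs. code_sum (map (\<lambda>i. F i xs) is))" if "set is \<subseteq> {..<k}" for "is"
    using that by (induction "is") (auto simp: code_sum_def intro: rec.const recursive_code F)
  from this[of "[0..<k]"] show ?thesis by (simp add: atLeast0LessThan)
qed

text \<open>Truncated subtraction of the two components. Negative integers go to 0, so every code is
  normalized to a natural number.\<close>

lemma recursive_nat_decode: "recursive p F \<Longrightarrow> recursive p (\<lambda>xs. nat (decode (F xs)))"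
proof -
  assume F: "recursive p F"
  have "nat (decode c) = fst (prod_decode c) - snd (prod_decode c)" for c
    by (simp add: decode_def)
  then show ?thesis
    using F by (simp add: recursive_diff recursive_prod_decode)
qed

definition tracks :: "nat \<Rightarrow> (nat list \<Rightarrow> nat) \<Rightarrow> (int list \<rightharpoonup> int) \<Rightarrow> bool" where
  "tracks p F f \<longleftrightarrow> recursive p F \<and>
     (\<forall>cs. length cs = p \<longrightarrow> map decode cs \<in> dom f \<longrightarrow> f (map decode cs) = Some (decode (F cs)))"

text \<open>A domain contains the zero tuple, so the length of its elements recovers the arity,
  which a map does not record by itself.\<close>

lemma nlists_eq_length:
  fixes A :: "int list set"
  assumes "A = nlists p S" "S = \<nat> \<or> S = UNIV" "\<And>xs. xs \<in> A \<Longrightarrow> length xs = q"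
  shows "q = (p::nat)"
  using assms(3)[of "replicate p (0::int)"] assms(1,2) by (auto simp: in_nlists_iff set_replicate_conv_if)

lemma tracksD:
  "tracks p F f \<Longrightarrow> length cs = p \<Longrightarrow> map decode cs \<in> dom f \<Longrightarrow> f (map decode cs) = Some (decode (F cs))"
  by (simp add: tracks_def)

lemma tracks_LI:
  assumes G: "\<And>i. i < k \<Longrightarrow> dom (G i) = nlists p \<nat> \<and> tracks p (GF i) (G i)"
    and A: "\<And>i j. i < k \<Longrightarrow> j < k \<Longrightarrow> dom (A i j) = nlists (p + 1) \<nat> \<and> tracks (p + 1) (AF i j) (A i j)"
    and B: "\<And>i. i < k \<Longrightarrow> dom (B i) = nlists (p + 1) \<nat> \<and> tracks (p + 1) (BF i) (B i)"
    and LI: "is_LI p k G A B f" and i: "i < k"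
  shows "\<exists>F. tracks (p + 1) F (f i)"
proof -
  \<comment> \<open>The arguments \<open>zs\<close> are the number \<open>x\<close>, the
    \<open>k\<close> codes of the current state, and the codes of the parameters. The functions
    tracking \<open>A\<close> and \<open>B\<close> expect codes only, hence
    \<open>code_nat\<close>.\<close>
  define H where "H i zs = code_add (zs ! Suc i) (code_add
    (code_sum (map (\<lambda>j. code_mult (AF i j (code_nat (zs ! 0) # drop (Suc k) zs)) (zs ! Suc j)) [0..<k]))
    (BF i (code_nat (zs ! 0) # drop (Suc k) zs)))" for i zs
  define V where "V x ys = rec_nat (map (\<lambda>i. GF i ys) [0..<k])
    (\<lambda>x v. map (\<lambda>i. H i (x # v @ ys)) [0..<k]) x" for x ys
  have len: "length (V x ys) = k" for x ys
    by (cases x) (auto simp: V_def)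
  have param: "recursive (Suc (k + p)) (\<lambda>zs. F (code_nat (zs ! 0) # drop (Suc k) zs))"
    if "recursive (p + 1) F" for F
    using rec.subst[OF that, of "[\<lambda>zs. code_nat (zs ! 0)]" p "Suc k" "Suc (k + p)"]
    by (simp add: recursive_code_nat rec.proj)
  have "recursive (Suc (k + p)) (H i)" if "i < k" for i
    unfolding H_def
    by (intro recursive_code recursive_code_sum param rec.proj)
      (use A B that in \<open>auto simp: tracks_def\<close>)
  then have V: "recursive (Suc p) (\<lambda>xs. V (xs ! 0) (drop 1 xs) ! i)"
    by (intro recursive_simultaneous[where G = GF and H = H])
      (use G i in \<open>auto simp: V_def tracks_def\<close>)
  have "recursive (Suc p) (\<lambda>xs. nat (decode (xs ! 0)))"
    by (intro recursive_nat_decode rec.proj) simp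
  \<comment> \<open>The first argument also arrives as a code and is turned into the number of
    recursion steps.\<close>
  then have rec: "recursive (Suc p) (\<lambda>xs. V (nat (decode (xs ! 0))) (drop 1 xs) ! i)"
    using rec.subst[OF V, of "[\<lambda>xs. nat (decode (xs ! 0))]" p 1 "Suc p"] by simp
  \<comment> \<open>All components are treated together, because one component at
    \<open>x + 1\<close> depends on every component at \<open>x\<close>.\<close>
  have val: "f i (int x # map decode cs) = Some (decode (V x cs ! i))"
    if i: "i < k" and cs: "map decode cs \<in> nlists p \<nat>" for i x cs
    using i
  proof (induction x arbitrary: i)
    case 0
    then show ?case
      using LI cs G[OF 0] by (auto simp: is_LI_def V_def tracks_def in_nlists_iff)
  next
    case (Suc x)
    let ?z = "int x # map decode cs"
    have args: "map decode (code_nat x # cs) \<in> nlists (p + 1) \<nat>"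
      using cs by (simp add: in_nlists_iff)
    have Az: "A i j ?z = Some (decode (AF i j (code_nat x # cs)))" if "j < k" for j
      using tracksD[of "p + 1" "AF i j" "A i j" "code_nat x # cs"] A[OF Suc.prems that] args
      by (simp add: in_nlists_iff)
    have Bz: "B i ?z = Some (decode (BF i (code_nat x # cs)))"
      using tracksD[of "p + 1" "BF i" "B i" "code_nat x # cs"] B[OF Suc.prems] args
      by (simp add: in_nlists_iff)
    \<comment> \<open>The difference equation speaks of \<open>the\<close>, so the definedness of
      \<open>f i\<close> at \<open>x + 1\<close> has to come from its domain.\<close>
    have "dom (f i) = nlists (p + 1) \<nat>"
      using LI Suc.prems by (simp add: is_LI_def)
    then have "int (Suc x) # map decode cs \<in> dom (f i)"
      using cs by (simp add: in_nlists_iff del: of_nat_Suc domIff)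
    then obtain w where w: "f i (int (Suc x) # map decode cs) = Some w" by blast
    have "the (f i ((int x + 1) # map decode cs)) - the (f i ?z) =
        (\<Sum>j<k. the (A i j ?z) * the (f j ?z)) + the (B i ?z)"
      using LI Suc.prems cs by (simp add: is_LI_def)
    then have "w = decode (V x cs ! i) +
        ((\<Sum>j<k. decode (AF i j (code_nat x # cs)) * decode (V x cs ! j)) + decode (BF i (code_nat x # cs)))"
      using w Suc.IH Suc.prems by (simp add: Az Bz add.commute)
    also have "\<dots> = decode (H i (x # V x cs @ cs))"
      using len Suc.prems
      by (simp add: H_def nth_append comp_def interv_sum_list_conv_sum_set_nat atLeast0LessThan)
    also have "H i (x # V x cs @ cs) = V (Suc x) cs ! i"
      using Suc.prems by (simp add: V_def)
    finally show ?case using w by simp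
  qed
  have "f i (map decode cs) = Some (decode (V (nat (decode (cs ! 0))) (drop 1 cs) ! i))"
    if len: "length cs = p + 1" and dom: "map decode cs \<in> dom (f i)" for cs
  proof -
    from len obtain c ds where [simp]: "cs = c # ds" by (cases cs) auto
    have "map decode cs \<in> nlists (p + 1) \<nat>"
      using LI i dom by (auto simp: is_LI_def)
    then show ?thesis
      using val[OF i, of ds "nat (decode c)"] by (simp add: Nats_int_nonneg)
  qed
  with rec show ?thesis
    by (auto simp: tracks_def)
qed

lemma tracks_SMIN:
  assumes g: "tracks (p + 1) F g" and dom: "dom g = nlists (p + 1) \<nat>" and ran: "ran g \<subseteq> \<nat>"
    and ex: "\<forall>y\<in>nlists p \<nat>. \<exists>n::nat. g (int n # y) = Some 0"
  shows "\<exists>F. tracks p F ((\<lambda>y. Some (int (LEAST n. g (int n # y) = Some 0))) |` nlists p \<nat>)"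
proof -
  \<comment> \<open>At canonical codes of natural numbers \<open>g\<close> is defined and its values
    are natural, so \<open>nat\<close> turns no negative value into 0.\<close>
  have zero_iff: "g (int n # map int xs) = Some 0 \<longleftrightarrow> nat (decode (F (map code_nat (n # xs)))) = 0"
    if "length xs = p" for n xs
  proof -
    have args: "map decode (map code_nat (n # xs)) = int n # map int xs"
      by (simp add: comp_def)
    have "int n # map int xs \<in> dom g"
      using dom that by (auto simp: in_nlists_iff)
    then have "g (int n # map int xs) = Some (decode (F (map code_nat (n # xs))))"
      using g that args unfolding tracks_def by (metis length_map length_Cons Suc_eq_plus1)
    moreover from this have "decode (F (map code_nat (n # xs))) \<in> \<nat>"
      using ran by (auto simp: ran_def)
    ultimately show ?thesis
      by (auto elim: Nats_cases)
  qed
  have "recursive (Suc p) (\<lambda>xs. F (map (\<lambda>G. G xs) (map (\<lambda>i xs. code_nat (xs ! i)) [0..<Suc p])))"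
    by (rule rec.comp) (use g in \<open>auto simp: tracks_def recursive_code_nat rec.proj simp del: upt_Suc\<close>)
  then have "recursive (Suc p) (\<lambda>xs. F (map code_nat xs))"
  proof (rule recursive_cong)
    fix xs :: "nat list" assume "length xs = Suc p"
    then have "map (\<lambda>G. G xs) (map (\<lambda>i xs. code_nat (xs ! i)) [0..<Suc p]) = map code_nat xs"
      by (intro nth_equalityI) (auto simp del: upt_Suc)
    then show "F (map (\<lambda>G. G xs) (map (\<lambda>i xs. code_nat (xs ! i)) [0..<Suc p])) = F (map code_nat xs)"
      by simp
  qed
  then have nat_F: "recursive (Suc p) (\<lambda>xs. nat (decode (F (map code_nat xs))))"
    by (rule recursive_nat_decode)
  define m where "m xs = (LEAST n. nat (decode (F (map code_nat (n # xs)))) = 0)" for xs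
  have "recursive p m"
    unfolding m_def
  proof (rule recursive_LEAST[OF nat_F])
    fix xs :: "nat list" assume xs: "length xs = p"
    then have "map int xs \<in> nlists p \<nat>"
      by (auto simp: in_nlists_iff)
    with ex have "\<exists>n. g (int n # map int xs) = Some 0"
      by blast
    then show "\<exists>n. nat (decode (F (map code_nat (n # xs)))) = 0"
      by (simp only: zero_iff[OF xs])
  qed
  \<comment> \<open>Outside the domain of \<open>g\<close>, a search with \<open>F\<close> might
    never end. The search in \<open>m\<close> uses canonical codes, and the arguments are first
    normalized to natural numbers, so it always ends.\<close>
  then have "recursive p (\<lambda>cs. m (map (\<lambda>G. G cs) (map (\<lambda>i cs. nat (decode (cs ! i))) [0..<p])))"
    by (intro rec.comp) (auto simp: recursive_nat_decode rec.proj)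
  then have "recursive p (\<lambda>cs. m (map (\<lambda>c. nat (decode c)) cs))"
  proof (rule recursive_cong)
    fix cs :: "nat list" assume "length cs = p"
    then have "map (\<lambda>G. G cs) (map (\<lambda>i cs. nat (decode (cs ! i))) [0..<p]) = map (\<lambda>c. nat (decode c)) cs"
      by (intro nth_equalityI) auto
    then show "m (map (\<lambda>G. G cs) (map (\<lambda>i cs. nat (decode (cs ! i))) [0..<p])) = m (map (\<lambda>c. nat (decode c)) cs)"
      by simp
  qed
  then have "recursive p (\<lambda>cs. code_nat (m (map (\<lambda>c. nat (decode c)) cs)))"
    by (rule recursive_code_nat)
  moreover have "(LEAST n. g (int n # map decode cs) = Some 0) = m (map (\<lambda>c. nat (decode c)) cs)"
    if "map decode cs \<in> nlists p \<nat>" for cs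
  proof -
    have "map int (map (\<lambda>c. nat (decode c)) cs) = map decode cs"
      using that by (auto simp: in_nlists_iff Nats_int_nonneg subset_iff)
    moreover have "length (map (\<lambda>c. nat (decode c)) cs) = p"
      using that by (simp add: in_nlists_iff)
    ultimately show ?thesis
      unfolding m_def by (metis (no_types, lifting) zero_iff)
  qed
  ultimately show ?thesis
    by (intro exI[of _ "\<lambda>cs. code_nat (m (map (\<lambda>c. nat (decode c)) cs))"]) (simp add: tracks_def)
qed

lemma ODE_class_tracked: "f \<in> ODE_class \<Longrightarrow> \<exists>p F. (\<forall>xs\<in>dom f. length xs = p) \<and> tracks p F f"
proof (induction rule: ODE_class.induct)
  case (zero p)
  show ?case
    by (intro exI[of _ p] exI[of _ "\<lambda>_. code_nat 0"])
      (auto simp: tracks_def in_nlists_iff intro: rec.const)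
next
  case (proj i p)
  then show ?case
    by (intro exI[of _ p] exI[of _ "\<lambda>cs. cs ! i"]) (auto simp: tracks_def in_nlists_iff intro: rec.proj)
next
  case succ
  have "recursive 1 (\<lambda>cs. code_add (cs ! 0) (code_nat 1))"
    by (intro recursive_code recursive_code_nat rec.const rec.proj) auto
  then show ?case
    by (intro exI[of _ 1] exI[of _ "\<lambda>cs. code_add (cs ! 0) (code_nat 1)"])
      (auto simp: tracks_def in_nlists_iff)
next
  case add
  have "recursive 2 (\<lambda>cs. code_add (cs ! 0) (cs ! 1))"
    by (intro recursive_code rec.proj) auto
  then show ?case
    by (intro exI[of _ 2] exI[of _ "\<lambda>cs. code_add (cs ! 0) (cs ! 1)"])
      (auto simp: tracks_def in_nlists_iff)
next
  case sub
  have "recursive 2 (\<lambda>cs. code_diff (cs ! 0) (cs ! 1))"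
    by (intro recursive_code rec.proj) auto
  then show ?case
    by (intro exI[of _ 2] exI[of _ "\<lambda>cs. code_diff (cs ! 0) (cs ! 1)"])
      (auto simp: tracks_def in_nlists_iff)
next
  case (comp f S gs p)
  from comp.IH obtain q F where f: "\<forall>xs\<in>dom f. length xs = q" and F: "tracks q F f"
    by blast
  have "\<exists>G. tracks p G g" if "g \<in> set gs" for g
    using comp.hyps comp.IH that nlists_eq_length[of "dom g" p S] by metis
  then obtain G where G: "\<And>g. g \<in> set gs \<Longrightarrow> tracks p (G g) g" by metis
  \<comment> \<open>Evaluation at the zero tuple shows that the number of inner functions is the
    arity \<open>q\<close> of \<open>f\<close>: the tuple of their values lies in
    \<open>dom f\<close>.\<close>
  have "replicate p 0 \<in> nlists p S"
    using comp.hyps by (auto simp: in_nlists_iff)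
  then have "map (\<lambda>g. the (g (replicate p 0))) gs \<in> dom f"
    using comp.hyps by blast
  from bspec[OF f this] have q: "length gs = q"
    by simp
  have "recursive p (\<lambda>cs. F (map (\<lambda>G. G cs) (map G gs)))"
    by (rule rec.comp) (use F G q in \<open>auto simp: tracks_def\<close>)
  moreover have "f (map (\<lambda>g. the (g (map decode cs))) gs) = Some (decode (F (map (\<lambda>G. G cs) (map G gs))))"
    if "map decode cs \<in> nlists p S" for cs
  proof -
    have "g (map decode cs) = Some (decode (G g cs))" if "g \<in> set gs" for g
      using tracksD[OF G[OF that], of cs] comp.IH(2) that \<open>map decode cs \<in> nlists p S\<close>
      by (simp add: in_nlists_iff)
    then have "\<forall>g\<in>set gs. the (g (map decode cs)) = decode (G g cs)"
      by (metis option.sel)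
    then have eq: "map (\<lambda>g. the (g (map decode cs))) gs = map decode (map (\<lambda>G. G cs) (map G gs))"
      by simp
    have "map (\<lambda>g. the (g (map decode cs))) gs \<in> dom f"
      using comp.hyps that by blast
    with q show ?thesis
      unfolding eq by (intro tracksD[OF F]) simp_all
  qed
  ultimately show ?case
    by (intro exI[of _ p] exI[of _ "\<lambda>cs. F (map (\<lambda>G. G cs) (map G gs))"])
      (auto simp: tracks_def in_nlists_iff restrict_map_def dom_def)
next
  case (LI k G p A B f i)
  have "\<exists>F. tracks p F (G i)" if "i < k" for i
    using LI.IH(1) that nlists_eq_length[of "dom (G i)" p \<nat>] by metis
  then obtain GF where GF: "\<And>i. i < k \<Longrightarrow> tracks p (GF i) (G i)" by metis
  have "\<exists>F. tracks (p + 1) F (A i j)" if "i < k" "j < k" for i j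
    using LI.IH(2) that nlists_eq_length[of "dom (A i j)" "p + 1" \<nat>] by metis
  then obtain AF where AF: "\<And>i j. i < k \<Longrightarrow> j < k \<Longrightarrow> tracks (p + 1) (AF i j) (A i j)" by metis
  have "\<exists>F. tracks (p + 1) F (B i)" if "i < k" for i
    using LI.IH(3) that nlists_eq_length[of "dom (B i)" "p + 1" \<nat>] by metis
  then obtain BF where BF: "\<And>i. i < k \<Longrightarrow> tracks (p + 1) (BF i) (B i)" by metis
  have "\<exists>F. tracks (p + 1) F (f i)"
    by (rule tracks_LI[of k G p GF A AF B BF])
      (use LI.IH LI.hyps GF AF BF in auto)
  moreover have "dom (f i) = nlists (p + 1) \<nat>"
    using LI.hyps by (simp add: is_LI_def)
  ultimately show ?case
    by (auto simp: in_nlists_iff)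
next
  case (SMIN g p)
  then obtain F where F: "tracks (p + 1) F g"
    using nlists_eq_length[of "dom g" "p + 1" \<nat>] by metis
  obtain F' where "tracks p F' ((\<lambda>y. Some (int (LEAST n. g (int n # y) = Some 0))) |` nlists p \<nat>)"
    using tracks_SMIN[OF F] SMIN.hyps by blast
  then show ?case
    by (intro exI[of _ p] exI[of _ F'] conjI ballI) (simp_all only: dom_restrict_Some in_nlists_iff)
qed

section \<open>Return from codes to natural numbers\<close>

lemma ODE_class_recursive:
  assumes f: "f \<in> ODE_class" and dom: "dom f = nlists p \<nat>" and ran: "ran f \<subseteq> \<nat>"
  shows "f \<in> int_fun ` total_recursive"
proof -
  obtain q F where q: "\<forall>xs\<in>dom f. length xs = q" and F: "tracks q F f"
    using ODE_class_tracked[OF f] by blast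
  have "q = p"
    using nlists_eq_length[OF dom] q by blast
  with F have F: "tracks p F f" by simp
  \<comment> \<open>Natural arguments enter as canonical codes and the result is decoded;
    \<open>nat\<close> loses nothing, since the values of \<open>f\<close> are natural.\<close>
  have "recursive p (\<lambda>xs. F (map (\<lambda>G. G xs) (map (\<lambda>i xs. code_nat (xs ! i)) [0..<p])))"
    by (rule rec.comp) (use F in \<open>auto simp: tracks_def recursive_code_nat rec.proj\<close>)
  from recursive_nat_decode[OF this]
  have "recursive p (\<lambda>xs. nat (decode (F (map code_nat xs))))"
  proof (rule recursive_cong)
    fix xs :: "nat list" assume "length xs = p"
    then have "map (\<lambda>G. G xs) (map (\<lambda>i xs. code_nat (xs ! i)) [0..<p]) = map code_nat xs"
      by (intro nth_equalityI) auto
    then show "nat (decode (F (map (\<lambda>G. G xs) (map (\<lambda>i xs. code_nat (xs ! i)) [0..<p])))) =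
        nat (decode (F (map code_nat xs)))"
      by simp
  qed
  then have "(\<lambda>xs. Some (nat (decode (F (map code_nat xs))))) |` nlists p UNIV \<in> total_recursive"
    (is "?h \<in> _") by (auto simp: total_recursive_def recursive_def)
  moreover have "f = int_fun ?h"
  proof
    fix xs :: "int list"
    show "f xs = int_fun ?h xs"
    proof (cases "xs \<in> nlists p \<nat>")
      case True
      then have "map decode (map code_nat (map nat xs)) = xs"
        by (auto simp: in_nlists_iff intro!: map_idI dest!: subsetD elim: Nats_cases)
      then have val: "f xs = Some (decode (F (map code_nat (map nat xs))))"
        using F True dom unfolding tracks_def in_nlists_iff by (metis length_map True)
      then have "decode (F (map code_nat (map nat xs))) \<in> \<nat>"
        using ran by (auto simp: ran_def)
      then show ?thesis
        using val True by (simp add: int_fun_def in_nlists_iff Nats_int_nonneg)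
    next
      case False
      then have "f xs = None" using dom by blast
      with False show ?thesis by (auto simp: int_fun_def in_nlists_iff)
    qed
  qed
  ultimately show ?thesis by blast
qed

theorem mainTheorem4:
  "int_fun ` total_recursive =
     {f \<in> ODE_class. (\<exists>p. dom f = nlists p \<nat>) \<and> ran f \<subseteq> \<nat>}"
proof
  show "int_fun ` total_recursive \<subseteq> {f \<in> ODE_class. (\<exists>p. dom f = nlists p \<nat>) \<and> ran f \<subseteq> \<nat>}"
  proof
    fix F assume "F \<in> int_fun ` total_recursive"
    then obtain p f where f: "partial_recursive p f" "dom f = nlists p UNIV" and F: "F = int_fun f"
      by (auto simp: total_recursive_def)
    have "F = (\<lambda>xs. Some (int (the (f (map nat xs))))) |` nlists p \<nat>"
      unfolding F by (rule int_fun_eq_restrict[OF f(2)])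
    then show "F \<in> {f \<in> ODE_class. (\<exists>p. dom f = nlists p \<nat>) \<and> ran f \<subseteq> \<nat>}"
      using ode_total_recursive[OF f] by (auto simp: ode_def ode_int_def)
  qed
  show "{f \<in> ODE_class. (\<exists>p. dom f = nlists p \<nat>) \<and> ran f \<subseteq> \<nat>} \<subseteq> int_fun ` total_recursive"
    using ODE_class_recursive by blast
qed

end
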